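(* Let $X\neq\emptyset$ be a set and let $\mathcal E\colon \mathcal F(X)\to[0,\infty]$ be convex with $\mathcal E(0)=0$. Assume that $\mathcal E$ is symmetric and reflexive. The following assertions are equivalent: (i) $\mathcal E$ is lower semicontinuous with $\ker\|\cdot\|_L=\{0\}$ and $R(x,y)<\infty$ for all $x,y\in X$. (ii) $\mathcal E$ is left-continuous, $(M(\mathcal E),\|\cdot\|_L)$ is a Banach space and $R_\infty(x)<\infty$ for all $x\in X$.
   Context: $\mathcal F(X)$ is the real vector space of all functions $f\colon X\to\mathbb R$, equipped with the locally convex topology of pointwise convergence. For $\mathcal E\colon\mathcal F(X)\to[0,\infty]$ convex with $\mathcal E(0)=0$: - $\mathcal E$ is symmetric if $\mathcal E(f)=\mathcal E(-f)$ for all $f$. - $\mathcal E$ is left-continuous if $\lim_{\lambda\to1-}\mathcal E(\lambda f)=\mathcal E(f)$ for all $f$. - $\mathcal E$ is lower semicontinuous if $\mathcal E(f)\le\liminf_i\mathcal E(f_i)$ for every net $(f_i)$ converging pointwise to $f$. - The modular cone is $M(\mathcal E)=\{f\in\mathcal F(X)\mid\lim_{\alpha\to0+}\mathcal E(\alpha f)=0\}$; the Luxemburg functional is $\|f\|_L=\inf\{\lambda>0\mid\mathcal E(\lambda^{-1}f)\le1\}$ for $f\in M(\mathcal E)$. If $\mathcal E$ is symmetric, $M(\mathcal E)$ is a vector space and $\|\cdot\|_L$ is a seminorm on it, with $\ker\|\cdot\|_L=\{f\in M(\mathcal E)\mid\|f\|_L=0\}$. - A symmetric $\mathcal E$ is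 reflexive if the image of the seminormed space $(M(\mathcal E),\|\cdot\|_L)$ under the natural (isometric, possibly non-injective) map $f\mapsto(\varphi\mapsto\varphi(f))$ into its bidual is dense in the bidual. - The elementary resistance is $R(x,y)=\sup\{f(x)-f(y)\mid f\in\mathcal F(X),\ \mathcal E(f)\le1\}\in[0,\infty]$, and the elementary resistance between $x$ and $\infty$ is $R_\infty(x)=\sup\{f(x)\mid f\in\mathcal F(X),\ \mathcal E(f)\le1\}\in[0,\infty]$, for $x,y\in X$. *)

theory Defs
  imports "HOL-Analysis.Analysis" "HOL-Library.Function_Algebras"
begin

text \<open>The library makes \<^typ>\<open>'a \<Rightarrow> 'b\<close> a group under pointwise addition, but provides no
  scalar multiplication; with it \<^typ>\<open>'x \<Rightarrow> real\<close> is the real vector space of all functions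
  on \<open>X\<close>, where the set \<open>X\<close> is rendered as a type.\<close>

instantiation "fun" :: (type, real_vector) real_vector
begin

definition scaleR_fun :: "real \<Rightarrow> ('a \<Rightarrow> 'b) \<Rightarrow> 'a \<Rightarrow> 'b" where
  "scaleR_fun c f = (\<lambda>x. c *\<^sub>R f x)"

instance
  by standard (auto simp: scaleR_fun_def fun_eq_iff algebra_simps)

end

subsection \<open>Seminormed spaces on a carrier\<close>

text \<open>A seminormed space is given by a linear subspace \<open>V\<close> of an ambient real vector space and
  a function \<open>p\<close>, only the values of which on \<open>V\<close> matter. Linear functionals on \<open>V\<close> are
  extended by \<open>0\<close> off \<open>V\<close>, so that equality and the pointwise operations on them are those of
  functionals on \<open>V\<close>.\<close>

definition dual_space :: "'v::real_vector set \<Rightarrow> ('v \<Rightarrow> real) \<Rightarrow> ('v \<Rightarrow> real) set" where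
  "dual_space V p = {\<phi>.
     (\<forall>f. f \<notin> V \<longrightarrow> \<phi> f = 0) \<and>
     (\<forall>f\<in>V. \<forall>g\<in>V. \<phi> (f + g) = \<phi> f + \<phi> g) \<and>
     (\<forall>c. \<forall>f\<in>V. \<phi> (c *\<^sub>R f) = c * \<phi> f) \<and>
     (\<exists>C. \<forall>f\<in>V. \<bar>\<phi> f\<bar> \<le> C * p f)}"

definition dual_norm :: "'v::real_vector set \<Rightarrow> ('v \<Rightarrow> real) \<Rightarrow> ('v \<Rightarrow> real) \<Rightarrow> real" where
  "dual_norm V p \<phi> = (SUP f\<in>{f \<in> V. p f \<le> 1}. \<bar>\<phi> f\<bar>)"

definition bidual_space ::
    "'v::real_vector set \<Rightarrow> ('v \<Rightarrow> real) \<Rightarrow> (('v \<Rightarrow> real) \<Rightarrow> real) set" where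
  "bidual_space V p = dual_space (dual_space V p) (dual_norm V p)"

definition bidual_norm ::
    "'v::real_vector set \<Rightarrow> ('v \<Rightarrow> real) \<Rightarrow> (('v \<Rightarrow> real) \<Rightarrow> real) \<Rightarrow> real" where
  "bidual_norm V p = dual_norm (dual_space V p) (dual_norm V p)"

definition natural_map ::
    "'v::real_vector set \<Rightarrow> ('v \<Rightarrow> real) \<Rightarrow> 'v \<Rightarrow> ('v \<Rightarrow> real) \<Rightarrow> real" where
  "natural_map V p f = (\<lambda>\<phi>. if \<phi> \<in> dual_space V p then \<phi> f else 0)"

definition banach_space_on :: "'v::real_vector set \<Rightarrow> ('v \<Rightarrow> real) \<Rightarrow> bool" where
  "banach_space_on V p \<longleftrightarrow>
     subspace V \<and>
     (\<forall>f\<in>V. 0 \<le> p f \<and> (p f = 0 \<longleftrightarrow> f = 0)) \<and>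
     (\<forall>c. \<forall>f\<in>V. p (c *\<^sub>R f) = \<bar>c\<bar> * p f) \<and>
     (\<forall>f\<in>V. \<forall>g\<in>V. p (f + g) \<le> p f + p g) \<and>
     (\<forall>u :: nat \<Rightarrow> 'v. (\<forall>n. u n \<in> V) \<and>
        (\<forall>\<epsilon>>0. \<exists>N. \<forall>m\<ge>N. \<forall>n\<ge>N. p (u m - u n) < \<epsilon>) \<longrightarrow>
        (\<exists>l\<in>V. (\<lambda>n. p (u n - l)) \<longlonglongrightarrow> 0))"

subsection \<open>Functionals on the space of all functions\<close>

definition convex_functional :: "(('x \<Rightarrow> real) \<Rightarrow> ennreal) \<Rightarrow> bool" where
  "convex_functional E \<longleftrightarrow> (\<forall>f g. \<forall>u\<ge>0. \<forall>v\<ge>0. u + v = 1 \<longrightarrow>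
     E (u *\<^sub>R f + v *\<^sub>R g) \<le> ennreal u * E f + ennreal v * E g)"

definition symmetric_functional :: "(('x \<Rightarrow> real) \<Rightarrow> ennreal) \<Rightarrow> bool" where
  "symmetric_functional E \<longleftrightarrow> (\<forall>f. E f = E (- f))"

definition left_continuous :: "(('x \<Rightarrow> real) \<Rightarrow> ennreal) \<Rightarrow> bool" where
  "left_continuous E \<longleftrightarrow> (\<forall>f. ((\<lambda>c. E (c *\<^sub>R f)) \<longlongrightarrow> E f) (at_left 1))"

text \<open>Nets are rendered as filters: a net corresponds to the filter \<open>F\<close> generated by the images
  of its tails, \<^term>\<open>Liminf F E\<close> is then the limit inferior of \<open>E\<close> along the net, and every
  proper filter arises in this way (for \<^term>\<open>F = bot\<close> the condition is void). The lemma below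
  recovers the condition for families over an arbitrary index type.\<close>

definition lower_semicontinuous :: "(('x \<Rightarrow> real) \<Rightarrow> ennreal) \<Rightarrow> bool" where
  "lower_semicontinuous E \<longleftrightarrow> (\<forall>f. \<forall>F :: ('x \<Rightarrow> real) filter.
     (\<forall>x. ((\<lambda>g. g x) \<longlongrightarrow> f x) F) \<longrightarrow> E f \<le> Liminf F E)"

lemma lower_semicontinuousD:
  fixes g :: "'i \<Rightarrow> 'x \<Rightarrow> real"
  assumes "lower_semicontinuous E" and "\<And>x. ((\<lambda>i. g i x) \<longlongrightarrow> f x) F"
  shows "E f \<le> Liminf F (\<lambda>i. E (g i))"
proof -
  have "((\<lambda>h. h x) \<longlongrightarrow> f x) (filtermap g F)" for x
    using assms(2)[of x] by (simp add: filterlim_filtermap)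
  then have "E f \<le> Liminf (filtermap g F) E"
    using assms(1) unfolding lower_semicontinuous_def by blast
  also have "\<dots> \<le> Liminf F (\<lambda>i. E (g i))"
    by (rule Liminf_filtermap_le)
  finally show ?thesis .
qed

definition modular_cone :: "(('x \<Rightarrow> real) \<Rightarrow> ennreal) \<Rightarrow> ('x \<Rightarrow> real) set" where
  "modular_cone E = {f. ((\<lambda>\<alpha>. E (\<alpha> *\<^sub>R f)) \<longlongrightarrow> 0) (at_right 0)}"

text \<open>To be used on \<^term>\<open>modular_cone E\<close> only, where the set below is nonempty.\<close>

definition luxemburg :: "(('x \<Rightarrow> real) \<Rightarrow> ennreal) \<Rightarrow> ('x \<Rightarrow> real) \<Rightarrow> real" where
  "luxemburg E f = Inf {c. c > 0 \<and> E (inverse c *\<^sub>R f) \<le> 1}"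

definition luxemburg_kernel :: "(('x \<Rightarrow> real) \<Rightarrow> ennreal) \<Rightarrow> ('x \<Rightarrow> real) set" where
  "luxemburg_kernel E = {f \<in> modular_cone E. luxemburg E f = 0}"

definition reflexive_functional :: "(('x \<Rightarrow> real) \<Rightarrow> ennreal) \<Rightarrow> bool" where
  "reflexive_functional E \<longleftrightarrow>
     (\<forall>\<Phi> \<in> bidual_space (modular_cone E) (luxemburg E). \<forall>\<epsilon>>0. \<exists>f \<in> modular_cone E.
        bidual_norm (modular_cone E) (luxemburg E)
          (\<Phi> - natural_map (modular_cone E) (luxemburg E) f) < \<epsilon>)"

definition resistance :: "(('x \<Rightarrow> real) \<Rightarrow> ennreal) \<Rightarrow> 'x \<Rightarrow> 'x \<Rightarrow> ereal" where
  "resistance E x y = (SUP f\<in>{f. E f \<le> 1}. ereal (f x - f y))"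

definition resistance_infinity :: "(('x \<Rightarrow> real) \<Rightarrow> ennreal) \<Rightarrow> 'x \<Rightarrow> ereal" where
  "resistance_infinity E x = (SUP f\<in>{f. E f \<le> 1}. ereal (f x))"

end

theory Submission
  imports Defs
begin

text \<open>From (i) to (ii), a sequence in the unit ball with unbounded values at a point could be
  normalised so as to converge to the constant 1, by finiteness of the resistances; lower
  semicontinuity would put this constant into the kernel. Hence evaluations are bounded, Cauchy
  sequences converge pointwise, and lower semicontinuity turns this into norm convergence.
  Conversely, in a reflexive Banach space bounded nets cluster weakly, and sublevel sets
  are weakly closed by Hahn--Banach, because they are convex and, by left-continuity, norm closed.
  As evaluations are bounded, weak cluster points of a pointwise convergent net agree with its
  pointwise limit.\<close>

subsection \<open>Hahn--Banach separation\<close>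

text \<open>Reflexivity supplies only density of the image in the bidual, and a bounded filter
  clusters only in the bidual. The natural map is isometric, so completeness closes its image and
  the cluster point is represented by some \<open>h\<close> in \<open>modular_cone E\<close>.
  Evaluations identify \<open>h\<close> with the pointwise limit \<open>f\<close>. This is also how
  \<open>f\<close>, which is not assumed to lie in \<open>modular_cone E\<close>, is found to do so;
  only then do its norm distance to a sublevel set and a separating functional make sense. The
  spaces involved are carriers inside a type: a subspace of functions, its dual and its bidual, with
  functionals set to 0 off the carrier. Hahn--Banach is therefore proved for sublinear functionals
  on a whole type and brought to a carrier by a linear projection.\<close>

definition sublinear :: "('v::real_vector \<Rightarrow> real) \<Rightarrow> bool" where
  "sublinear q \<longleftrightarrow> (\<forall>x y. q (x + y) \<le> q x + q y) \<and> (\<forall>x. \<forall>c\<ge>0. q (c *\<^sub>R x) = c * q x)"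

lemma sublinear_add: "sublinear q \<Longrightarrow> q (x + y) \<le> q x + q y"
  and sublinear_scaleR: "sublinear q \<Longrightarrow> c \<ge> 0 \<Longrightarrow> q (c *\<^sub>R x) = c * q x"
  by (simp_all add: sublinear_def)

lemma sublinear_zero: "sublinear q \<Longrightarrow> q 0 = 0"
  using sublinear_scaleR[of q 0 0] by simp

lemma sublinear_neg: "sublinear q \<Longrightarrow> - q (- x) \<le> q x"
  using sublinear_add[of q x "- x"] sublinear_zero[of q] by simp

text \<open>With \<open>D\<close> a ray this shows that minimal sublinear functionals are linear, with \<open>D\<close> a convex
  cone it gives separation.\<close>

lemma sublinear_refine:
  fixes q :: "'v::real_vector \<Rightarrow> real" and D :: "('v \<times> real) set"
  assumes q: "sublinear q" and ne: "D \<noteq> {}"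
    and add: "\<And>v r w s. (v, r) \<in> D \<Longrightarrow> (w, s) \<in> D \<Longrightarrow> (v + w, r + s) \<in> D"
    and scale: "\<And>c w r. c \<ge> 0 \<Longrightarrow> (w, r) \<in> D \<Longrightarrow> (c *\<^sub>R w, c * r) \<in> D"
    and le: "\<And>w r. (w, r) \<in> D \<Longrightarrow> r \<le> q w"
  obtains q' where "sublinear q'" "\<And>x. q' x \<le> q x" "\<And>w r. (w, r) \<in> D \<Longrightarrow> q' (- w) \<le> - r"
proof -
  \<comment> \<open>The largest sublinear functional below \<open>q\<close> that is at most
    \<open>- r\<close> at \<open>- w\<close> for all pairs in \<open>D\<close>: any such
    \<open>s\<close> satisfies
    \<open>s x \<le> s (x + w) + s (- w) \<le> q (x + w) - r\<close>.\<close>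
  define q' where "q' x = (INF (w, r)\<in>D. q (x + w) - r)" for x
  have zero: "(0, 0) \<in> D"
    using ne scale[of 0] by fastforce
  \<comment> \<open>The hypothesis \<open>r \<le> q w\<close> keeps the infimum finite: it yields a
    lower bound independent of the pair.\<close>
  have low: "- q (- x) \<le> q (x + w) - r" if "(w, r) \<in> D" for x w r
    using le[OF that] sublinear_add[OF q, of "x + w" "- x"] by simp
  have bdd: "bdd_below ((\<lambda>(w, r). q (x + w) - r) ` D)" for x
    using low by (intro bdd_belowI2[where m = "- q (- x)"]) auto
  have upper: "q' x \<le> q (x + w) - r" if "(w, r) \<in> D" for x w r
    unfolding q'_def using cINF_lower[OF bdd that] by simp
  have greatest: "m \<le> q' x" if "\<And>w r. (w, r) \<in> D \<Longrightarrow> m \<le> q (x + w) - r" for m x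
    unfolding q'_def using ne that by (intro cINF_greatest) auto
  have sub: "q' (x + y) \<le> q' x + q' y" for x y
  proof -
    have "q' (x + y) - q' y \<le> q' x"
    proof (rule greatest)
      fix v r assume v: "(v, r) \<in> D"
      have "q' (x + y) - (q (x + v) - r) \<le> q' y"
      proof (rule greatest)
        fix w s assume w: "(w, s) \<in> D"
        have "q' (x + y) \<le> q ((x + v) + (y + w)) - (r + s)"
          using upper[OF add[OF v w], of "x + y"] by (simp add: algebra_simps)
        also have "\<dots> \<le> q (x + v) + q (y + w) - (r + s)"
          using sublinear_add[OF q] by simp
        finally show "q' (x + y) - (q (x + v) - r) \<le> q (y + w) - s"
          by simp
      qed
      then show "q' (x + y) - q' y \<le> q (x + v) - r"
        by simp
    qed
    then show ?thesis
      by simp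
  qed
  have le_scale: "q' (c *\<^sub>R x) \<le> c * q' x" if "c > 0" for c x
  proof -
    have "q' (c *\<^sub>R x) / c \<le> q' x"
    proof (rule greatest)
      fix w r assume "(w, r) \<in> D"
      then have "q' (c *\<^sub>R x) \<le> q (c *\<^sub>R x + c *\<^sub>R w) - c * r"
        using upper scale that by simp
      also have "\<dots> = c * (q (x + w) - r)"
        using sublinear_scaleR[OF q, of c "x + w"] that by (simp add: algebra_simps)
      finally show "q' (c *\<^sub>R x) / c \<le> q (x + w) - r"
        using that by (simp add: field_simps)
    qed
    then show ?thesis
      using that by (simp add: field_simps)
  qed
  have "q' 0 = 0"
    using upper[OF zero, of 0] greatest[of 0 0] le sublinear_zero[OF q] by fastforce
  moreover have "q' (c *\<^sub>R x) = c * q' x" if "c > 0" for c x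
    using le_scale[OF that, of x] le_scale[of "inverse c" "c *\<^sub>R x"] that
    by (simp add: field_simps)
  ultimately have "q' (c *\<^sub>R x) = c * q' x" if "c \<ge> 0" for c x
    using that by (cases "c = 0") auto
  then have "sublinear q'"
    using sub by (simp add: sublinear_def)
  moreover have "q' x \<le> q x" for x
    using upper[OF zero, of x] by simp
  moreover have "q' (- w) \<le> - r" if "(w, r) \<in> D" for w r
    using upper[OF that, of "- w"] sublinear_zero[OF q] by simp
  ultimately show thesis
    using that by blast
qed

text \<open>Zorn's lemma for the reversed pointwise order. The pointwise infimum of a chain stays
  finite because \<open>- q (- x) \<le> - s (- x) \<le> s x\<close> for every sublinear
  \<open>s \<le> q\<close>.\<close>

lemma ex_minimal_sublinear:
  fixes q :: "'v::real_vector \<Rightarrow> real"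
  assumes q: "sublinear q"
  obtains m where "sublinear m" "m \<le> q" "\<And>s. sublinear s \<Longrightarrow> s \<le> m \<Longrightarrow> s = m"
proof -
  define A where "A = {s. sublinear s \<and> s \<le> q}"
  have "\<exists>m\<in>A. \<forall>s\<in>A. s \<le> m \<longrightarrow> s = m"
  proof (rule predicate_Zorn[where P = "\<lambda>a b. b \<le> a"])
    show "partial_order_on A (relation_of (\<lambda>a b. b \<le> a) A)"
      by (rule partial_order_on_relation_ofI) auto
  next
    fix C assume "C \<in> Chains (relation_of (\<lambda>a b. b \<le> a) A)"
    then have C: "\<And>s. s \<in> C \<Longrightarrow> sublinear s" "\<And>s x. s \<in> C \<Longrightarrow> s x \<le> q x"
      and chain: "\<And>s t. s \<in> C \<Longrightarrow> t \<in> C \<Longrightarrow> s \<le> t \<or> t \<le> s"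
      by (auto simp: Chains_def relation_of_def A_def le_fun_def)
    show "\<exists>u\<in>A. \<forall>a\<in>C. u \<le> a"
    proof (cases "C = {}")
      case True
      then show ?thesis
        using q by (auto simp: A_def)
    next
      case False
      define u where "u x = (INF s\<in>C. s x)" for x
      have "bdd_below ((\<lambda>s. s x) ` C)" for x
      proof (rule bdd_belowI2)
        fix s assume "s \<in> C"
        then show "- q (- x) \<le> s x"
          using C(2)[of s "- x"] sublinear_neg[OF C(1), of s x] by simp
      qed
      then have lower: "u x \<le> s x" if "s \<in> C" for s x
        unfolding u_def using that by (rule cINF_lower)
      have greatest: "m \<le> u x" if "\<And>s. s \<in> C \<Longrightarrow> m \<le> s x" for m x
        unfolding u_def using False that by (rule cINF_greatest)
      have "u (x + y) \<le> u x + u y" for x y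
      proof -
        have "u (x + y) - u y \<le> u x"
        proof (rule greatest)
          fix s assume s: "s \<in> C"
          have "u (x + y) - s x \<le> u y"
          proof (rule greatest)
            fix t assume t: "t \<in> C"
            \<comment> \<open>Subadditivity of the infimum needs one member below both
              \<open>s\<close> and \<open>t\<close>; the chain property provides it.\<close>
            obtain r where r: "r \<in> C" "r \<le> s" "r \<le> t"
              using chain[OF s t] s t by auto
            have "u (x + y) \<le> r (x + y)"
              using lower r(1) .
            also have "\<dots> \<le> r x + r y"
              using C(1) r(1) by (simp add: sublinear_add)
            also have "\<dots> \<le> s x + t y"
              using r(2,3) by (simp add: le_fun_def add_mono)
            finally show "u (x + y) - s x \<le> t y"
              by simp
          qed
          then show "u (x + y) - u y \<le> s x"
            by simp
        qed
        then show ?thesis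
          by simp
      qed
      moreover have "u (c *\<^sub>R x) = c * u x" if "c \<ge> 0" for c x
      proof (cases "c = 0")
        case True
        have "(\<lambda>s. s (0::'v)) ` C = {0}"
          using C(1) sublinear_zero False by (auto simp: image_iff)
        then show ?thesis
          using True by (simp add: u_def)
      next
        case c: False
        with that have "c > 0" by simp
        have "u (c *\<^sub>R x) / c \<le> u x"
          using lower sublinear_scaleR[OF C(1)] \<open>c > 0\<close>
          by (intro greatest) (metis divide_le_eq mult.commute less_imp_le)
        moreover have "c * u x \<le> u (c *\<^sub>R x)"
          using \<open>c > 0\<close> that lower by (intro greatest) (simp add: sublinear_scaleR[OF C(1)])
        ultimately show ?thesis
          using \<open>c > 0\<close> by (simp add: field_simps)
      qed
      ultimately have "sublinear u"
        by (simp add: sublinear_def)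
      moreover have "u \<le> q"
        using False lower C(2) by (meson ex_in_conv le_funI order_trans)
      ultimately show ?thesis
        using lower by (auto simp: A_def le_fun_def)
    qed
  qed
  then obtain m where "m \<in> A" and "\<And>s. s \<in> A \<Longrightarrow> s \<le> m \<Longrightarrow> s = m"
    by blast
  with that[of m] show thesis
    by (auto simp: A_def intro: order_trans)
qed

text \<open>Refining \<open>m\<close> along the ray through \<open>(y, m y)\<close> gives a
  sublinear \<open>s \<le> m\<close> with \<open>s (- y) \<le> - m y\<close>. By minimality
  \<open>s = m\<close>, so \<open>m\<close> is odd, and for an odd functional subadditivity at
  \<open>- x\<close> and \<open>- y\<close> is the reverse inequality.\<close>

lemma minimal_sublinear_imp_linear:
  fixes m :: "'v::real_vector \<Rightarrow> real"
  assumes m: "sublinear m" and min: "\<And>s. sublinear s \<Longrightarrow> s \<le> m \<Longrightarrow> s = m"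
  shows "linear m"
proof -
  have neg: "m (- y) = - m y" for y
  proof -
    let ?D = "(\<lambda>t. (t *\<^sub>R y, t * m y)) ` {0..}"
    obtain s where s: "sublinear s" "\<And>x. s x \<le> m x" "\<And>w r. (w, r) \<in> ?D \<Longrightarrow> s (- w) \<le> - r"
    proof (rule sublinear_refine[OF m, of ?D])
      fix v r w s assume "(v, r) \<in> ?D" "(w, s) \<in> ?D"
      then obtain a b where "a \<ge> 0" "b \<ge> 0" "v = a *\<^sub>R y" "r = a * m y" "w = b *\<^sub>R y" "s = b * m y"
        by auto
      then show "(v + w, r + s) \<in> ?D"
        by (intro image_eqI[where x = "a + b"]) (auto simp: algebra_simps)
    next
      fix c w r assume "(c::real) \<ge> 0" "(w, r) \<in> ?D"
      then obtain a where "a \<ge> 0" "w = a *\<^sub>R y" "r = a * m y"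
        by auto
      then show "(c *\<^sub>R w, c * r) \<in> ?D"
        using \<open>c \<ge> 0\<close> by (intro image_eqI[where x = "c * a"]) auto
    qed (auto simp: sublinear_scaleR[OF m])
    have "(y, m y) \<in> ?D"
      by (rule image_eqI[where x = 1]) auto
    then have "s (- y) \<le> - m y"
      using s(3) by blast
    moreover have "s = m"
      using min s(1,2) by (simp add: le_fun_def)
    ultimately show ?thesis
      using sublinear_neg[OF m, of y] by simp
  qed
  have "m (x + y) = m x + m y" for x y
    using sublinear_add[OF m, of x y] sublinear_add[OF m, of "- x" "- y"] neg[of "x + y"] neg
    by simp
  moreover have "m (c *\<^sub>R x) = c * m x" for c x
    using sublinear_scaleR[OF m, of c x] sublinear_scaleR[OF m, of "- c" x] neg[of "c *\<^sub>R x"]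
    by (cases "c \<ge> 0") auto
  ultimately show ?thesis
    by (intro linearI) auto
qed

lemma sublinear_ex_linear:
  assumes "sublinear q"
  obtains f where "linear f" "\<And>x. f x \<le> q x"
  using ex_minimal_sublinear[OF assms] minimal_sublinear_imp_linear
  by (metis le_funD)

text \<open>Used twice over: for \<open>M\<close> with the Luxemburg functional and for a dual with
  \<open>dual_norm\<close>, so that the bidual is covered by the same lemmas as the dual.\<close>

definition seminorm_on :: "'v::real_vector set \<Rightarrow> ('v \<Rightarrow> real) \<Rightarrow> bool" where
  "seminorm_on V p \<longleftrightarrow> subspace V \<and> (\<forall>f\<in>V. 0 \<le> p f) \<and>
     (\<forall>c. \<forall>f\<in>V. p (c *\<^sub>R f) = \<bar>c\<bar> * p f) \<and> (\<forall>f\<in>V. \<forall>g\<in>V. p (f + g) \<le> p f + p g)"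

lemma seminorm_on_zero:
  assumes "seminorm_on V p"
  shows "0 \<in> V" "p 0 = 0"
proof -
  show "0 \<in> V"
    using assms by (simp add: seminorm_on_def subspace_0)
  then have "p (0 *\<^sub>R 0) = \<bar>0\<bar> * p 0"
    using assms unfolding seminorm_on_def by blast
  then show "p 0 = 0" by simp
qed

lemma seminorm_on_minus: "seminorm_on V p \<Longrightarrow> f \<in> V \<Longrightarrow> p (- f) = p f"
  unfolding seminorm_on_def by (metis abs_minus_cancel abs_one mult_1 scaleR_minus1_left)

text \<open>\<open>?D\<close> is the convex cone generated by the pairs \<open>(f - k, d)\<close>.
  Refining the seminorm by it and taking a linear functional below the result builds the gap
  \<open>d\<close> into that functional. It is applied to \<open>K = {0}\<close> with
  \<open>d = p f\<close> and to sublevel sets of \<open>E\<close>.\<close>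

lemma dual_space_separation:
  assumes p: "seminorm_on V p" and K: "K \<subseteq> V" "convex K" "K \<noteq> {}" and f: "f \<in> V"
    and d: "d \<ge> 0" "\<And>k. k \<in> K \<Longrightarrow> d \<le> p (f - k)"
  obtains \<phi> where "\<phi> \<in> dual_space V p" "\<And>g. g \<in> V \<Longrightarrow> \<bar>\<phi> g\<bar> \<le> p g"
    "\<And>k. k \<in> K \<Longrightarrow> \<phi> k + d \<le> \<phi> f"
proof -
  have V: "subspace V" and p_add: "\<And>f g. f \<in> V \<Longrightarrow> g \<in> V \<Longrightarrow> p (f + g) \<le> p f + p g"
    and p_scale: "\<And>c f. f \<in> V \<Longrightarrow> p (c *\<^sub>R f) = \<bar>c\<bar> * p f"
    using p by (auto simp: seminorm_on_def)
  \<comment> \<open>A linear projection onto \<open>V\<close>: the seminorm laws hold on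
    \<open>V\<close> only, whereas \<open>p (P x)\<close> is sublinear on the whole type.\<close>
  obtain P where P: "range P \<subseteq> V" "linear P" "\<And>v. v \<in> V \<Longrightarrow> P v = v"
    using linear_exists_left_inverse_on[OF linear_id V] by auto
  have sub: "sublinear (\<lambda>x. p (P x))"
    unfolding sublinear_def using P(1) p_add p_scale
    by (auto simp: linear_add[OF P(2)] linear_scale[OF P(2)] image_subset_iff)
  let ?D = "(\<lambda>(t, k). (t *\<^sub>R (f - k), t * d)) ` ({0..} \<times> K)"
  obtain q where q: "sublinear q" "\<And>x. q x \<le> p (P x)" "\<And>w r. (w, r) \<in> ?D \<Longrightarrow> q (- w) \<le> - r"
  proof (rule sublinear_refine[OF sub, of ?D])
    show "?D \<noteq> {}" using K by auto
  next
    fix v r w s assume "(v, r) \<in> ?D" "(w, s) \<in> ?D"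
    then obtain a k b l where *: "a \<ge> 0" "b \<ge> 0" "k \<in> K" "l \<in> K"
      "v = a *\<^sub>R (f - k)" "r = a * d" "w = b *\<^sub>R (f - l)" "s = b * d"
      by auto
    show "(v + w, r + s) \<in> ?D"
    proof (cases "a + b = 0")
      case True
      then have "a = 0" "b = 0" using * by auto
      then show ?thesis
        using * by (intro image_eqI[where x = "(0, k)"]) auto
    next
      case False
      then have ab: "a + b > 0" using * by auto
      \<comment> \<open>The weighted mean of \<open>k\<close> and \<open>l\<close> merges the two
        multiples into one; this is where convexity of \<open>K\<close> enters.\<close>
      define j where "j = (a / (a + b)) *\<^sub>R k + (b / (a + b)) *\<^sub>R l"
      have "j \<in> K"
        unfolding j_def using * ab False K(2) by (intro convexD) (auto simp: add_divide_distrib[symmetric])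
      moreover have "(a + b) *\<^sub>R j = a *\<^sub>R k + b *\<^sub>R l"
        using False by (simp add: j_def scaleR_add_right)
      moreover from this have "v + w = (a + b) *\<^sub>R (f - j)"
        using * by (simp add: scaleR_diff_right) (simp add: algebra_simps)
      ultimately show ?thesis
        using * by (intro image_eqI[where x = "(a + b, j)"]) (auto simp: distrib_right)
    qed
  next
    fix c w r assume "(c::real) \<ge> 0" "(w, r) \<in> ?D"
    then obtain a k where "a \<ge> 0" "k \<in> K" "w = a *\<^sub>R (f - k)" "r = a * d"
      by auto
    then show "(c *\<^sub>R w, c * r) \<in> ?D"
      using \<open>c \<ge> 0\<close> by (intro image_eqI[where x = "(c * a, k)"]) auto
  next
    fix w r assume "(w, r) \<in> ?D"
    then obtain a k where *: "a \<ge> 0" "k \<in> K" "w = a *\<^sub>R (f - k)" "r = a * d"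
      by auto
    then have "f - k \<in> V"
      using K f V by (auto intro: subspace_diff)
    then show "r \<le> p (P w)"
      using * d by (simp add: P(3) subspace_scale[OF V] p_scale mult_left_mono)
  qed auto
  obtain \<psi> where \<psi>: "linear \<psi>" "\<And>x. \<psi> x \<le> q x"
    using sublinear_ex_linear[OF q(1)] by blast
  have bound: "\<bar>\<psi> g\<bar> \<le> p g" if "g \<in> V" for g
  proof -
    have "\<psi> g \<le> p g"
      using \<psi>(2)[of g] q(2)[of g] P(3)[OF that] by simp
    moreover have "- \<psi> g \<le> p (- g)"
      using \<psi>(2)[of "- g"] q(2)[of "- g"] P(3)[of "- g"] that V
      by (simp add: linear_neg[OF \<psi>(1)] subspace_neg)
    ultimately show ?thesis
      using seminorm_on_minus[OF p that] by simp
  qed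
  have sep: "\<psi> k + d \<le> \<psi> f" if "k \<in> K" for k
  proof -
    have "(f - k, d) \<in> ?D"
      using that by (intro image_eqI[where x = "(1, k)"]) auto
    then have "\<psi> (- (f - k)) \<le> - d"
      using q(3) \<psi>(2) order_trans by blast
    then show ?thesis
      by (simp add: linear_diff[OF \<psi>(1)])
  qed
  define \<phi> where "\<phi> g = (if g \<in> V then \<psi> g else 0)" for g
  show thesis
  proof (rule that)
    show "\<phi> \<in> dual_space V p"
      using V bound linear_add[OF \<psi>(1)] linear_scale[OF \<psi>(1)]
      by (auto simp: dual_space_def \<phi>_def subspace_add subspace_scale intro!: exI[where x = 1])
  next
    show "\<bar>\<phi> g\<bar> \<le> p g" if "g \<in> V" for g
      using bound that by (simp add: \<phi>_def)
  next
    show "\<phi> k + d \<le> \<phi> f" if "k \<in> K" for k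
      using sep[OF that] that K(1) f by (auto simp: \<phi>_def)
  qed
qed

subsection \<open>Duals and biduals of seminormed spaces\<close>

lemma dual_spaceD:
  assumes "\<phi> \<in> dual_space V p"
  shows "f \<notin> V \<Longrightarrow> \<phi> f = 0"
    and "f \<in> V \<Longrightarrow> g \<in> V \<Longrightarrow> \<phi> (f + g) = \<phi> f + \<phi> g"
    and "f \<in> V \<Longrightarrow> \<phi> (c *\<^sub>R f) = c * \<phi> f"
  using assms by (auto simp: dual_space_def)

lemma dual_spaceI:
  assumes "\<And>f. f \<notin> V \<Longrightarrow> \<phi> f = 0"
    and "\<And>f g. f \<in> V \<Longrightarrow> g \<in> V \<Longrightarrow> \<phi> (f + g) = \<phi> f + \<phi> g"
    and "\<And>c f. f \<in> V \<Longrightarrow> \<phi> (c *\<^sub>R f) = c * \<phi> f"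
    and "\<And>f. f \<in> V \<Longrightarrow> \<bar>\<phi> f\<bar> \<le> C * p f"
  shows "\<phi> \<in> dual_space V p"
  using assms unfolding dual_space_def by blast

lemma dual_space_bound:
  assumes p: "seminorm_on V p" and \<phi>: "\<phi> \<in> dual_space V p"
  obtains C where "C \<ge> 0" "\<And>f. f \<in> V \<Longrightarrow> \<bar>\<phi> f\<bar> \<le> C * p f"
proof -
  obtain C where C: "\<And>f. f \<in> V \<Longrightarrow> \<bar>\<phi> f\<bar> \<le> C * p f"
    using \<phi> unfolding dual_space_def by blast
  have "\<bar>\<phi> f\<bar> \<le> \<bar>C\<bar> * p f" if "f \<in> V" for f
  proof -
    have "p f \<ge> 0"
      using p that by (simp add: seminorm_on_def)
    then show ?thesis
      using C[OF that] mult_right_mono[OF abs_ge_self] order_trans by blast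
  qed
  then show thesis
    using that[of "\<bar>C\<bar>"] by auto
qed

lemma subspace_dual_space:
  assumes p: "seminorm_on V p"
  shows "subspace (dual_space V p)"
proof (rule subspaceI)
  show "0 \<in> dual_space V p"
    by (auto simp: dual_space_def intro: exI[where x = 0])
next
  fix \<phi> \<psi> assume *: "\<phi> \<in> dual_space V p" "\<psi> \<in> dual_space V p"
  obtain B C where "\<And>f. f \<in> V \<Longrightarrow> \<bar>\<phi> f\<bar> \<le> B * p f" "\<And>f. f \<in> V \<Longrightarrow> \<bar>\<psi> f\<bar> \<le> C * p f"
    using dual_space_bound[OF p] * by metis
  then have "\<bar>\<phi> f + \<psi> f\<bar> \<le> (B + C) * p f" if "f \<in> V" for f
    using that by (smt (verit) distrib_right)
  then show "\<phi> + \<psi> \<in> dual_space V p"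
    by (intro dual_spaceI[where C = "B + C"]) (simp_all add: dual_spaceD[OF *(1)] dual_spaceD[OF *(2)] distrib_left)
next
  fix c \<phi> assume *: "\<phi> \<in> dual_space V p"
  obtain B where "\<And>f. f \<in> V \<Longrightarrow> \<bar>\<phi> f\<bar> \<le> B * p f"
    using dual_space_bound[OF p *] by metis
  then have "\<bar>(c *\<^sub>R \<phi>) f\<bar> \<le> (\<bar>c\<bar> * B) * p f" if "f \<in> V" for f
    using that by (simp add: scaleR_fun_def abs_mult mult.assoc mult_left_mono)
  then show "c *\<^sub>R \<phi> \<in> dual_space V p"
    by (rule dual_spaceI[rotated 3])
      (simp_all add: scaleR_fun_def dual_spaceD[OF *] distrib_left mult.left_commute)
qed

lemma dual_norm_upper:
  assumes p: "seminorm_on V p" and \<phi>: "\<phi> \<in> dual_space V p" and f: "f \<in> V" "p f \<le> 1"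
  shows "\<bar>\<phi> f\<bar> \<le> dual_norm V p \<phi>"
proof -
  obtain C where C: "C \<ge> 0" "\<And>f. f \<in> V \<Longrightarrow> \<bar>\<phi> f\<bar> \<le> C * p f"
    using dual_space_bound[OF p \<phi>] by blast
  have "\<bar>\<phi> g\<bar> \<le> C" if "g \<in> V" "p g \<le> 1" for g
    using C(2)[OF that(1)] mult_left_mono[OF that(2) C(1)] by simp
  then have "bdd_above ((\<lambda>g. \<bar>\<phi> g\<bar>) ` {g \<in> V. p g \<le> 1})"
    by (intro bdd_aboveI2[where M = C]) auto
  then show ?thesis
    unfolding dual_norm_def using f by (intro cSUP_upper) auto
qed

lemma dual_norm_least:
  assumes p: "seminorm_on V p" and "\<And>f. f \<in> V \<Longrightarrow> p f \<le> 1 \<Longrightarrow> \<bar>\<phi> f\<bar> \<le> C"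
  shows "dual_norm V p \<phi> \<le> C"
proof -
  have "0 \<in> {f \<in> V. p f \<le> 1}"
    using seminorm_on_zero[OF p] by simp
  then have "{f \<in> V. p f \<le> 1} \<noteq> {}" by blast
  then show ?thesis
    unfolding dual_norm_def using assms(2) by (intro cSUP_least) auto
qed

lemma dual_norm_bound:
  assumes p: "seminorm_on V p" and \<phi>: "\<phi> \<in> dual_space V p" and f: "f \<in> V"
  shows "\<bar>\<phi> f\<bar> \<le> dual_norm V p \<phi> * p f"
proof (cases "p f = 0")
  \<comment> \<open>Such an \<open>f\<close> cannot be normalised; the defining bound
    \<open>C * p f\<close> already gives \<open>\<phi> f = 0\<close>.\<close>
  case True
  then show ?thesis
    using dual_space_bound[OF p \<phi>] f by (metis mult_zero_right order.refl)
next
  case False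
  then have pos: "p f > 0"
    using p f by (simp add: seminorm_on_def order_less_le)
  have "\<bar>\<phi> (inverse (p f) *\<^sub>R f)\<bar> \<le> dual_norm V p \<phi>"
    using p f pos by (intro dual_norm_upper[OF p \<phi>]) (auto simp: seminorm_on_def subspace_scale)
  then show ?thesis
    using pos by (simp add: dual_spaceD(3)[OF \<phi> f] abs_mult field_simps)
qed

lemma seminorm_on_dual_norm:
  assumes p: "seminorm_on V p"
  shows "seminorm_on (dual_space V p) (dual_norm V p)"
proof -
  let ?W = "dual_space V p"
  have W: "subspace ?W" by (rule subspace_dual_space[OF p])
  note V0 = seminorm_on_zero[OF p]
  have nonneg: "0 \<le> dual_norm V p \<phi>" if "\<phi> \<in> ?W" for \<phi>
    using dual_norm_upper[OF p that V0(1)] V0(2) by simp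
  have le: "dual_norm V p (c *\<^sub>R \<phi>) \<le> \<bar>c\<bar> * dual_norm V p \<phi>" if "\<phi> \<in> ?W" for c \<phi>
    using dual_norm_upper[OF p that]
    by (intro dual_norm_least[OF p]) (simp add: scaleR_fun_def abs_mult mult_left_mono)
  have scale: "dual_norm V p (c *\<^sub>R \<phi>) = \<bar>c\<bar> * dual_norm V p \<phi>" if \<phi>: "\<phi> \<in> ?W" for c \<phi>
  proof (cases "c = 0")
    case True
    then show ?thesis
      using le[OF \<phi>, of 0] nonneg[OF subspace_0[OF W]] by simp
  next
    case False
    then show ?thesis
      using le[OF \<phi>, of c] le[OF subspace_scale[OF W \<phi>, of c], of "inverse c"]
      by (simp add: field_simps)
  qed
  have "dual_norm V p (\<phi> + \<psi>) \<le> dual_norm V p \<phi> + dual_norm V p \<psi>"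
    if "\<phi> \<in> ?W" "\<psi> \<in> ?W" for \<phi> \<psi>
    using dual_norm_upper[OF p that(1)] dual_norm_upper[OF p that(2)]
    by (intro dual_norm_least[OF p]) (smt (verit) plus_fun_apply)
  then show ?thesis
    using W nonneg scale by (simp add: seminorm_on_def)
qed

lemma natural_map_in_bidual_space:
  assumes p: "seminorm_on V p" and f: "f \<in> V"
  shows "natural_map V p f \<in> bidual_space V p"
proof -
  have "\<bar>\<phi> f\<bar> \<le> p f * dual_norm V p \<phi>" if "\<phi> \<in> dual_space V p" for \<phi>
    using dual_norm_bound[OF p that f] by (simp add: mult.commute)
  moreover have "\<phi> + \<psi> \<in> dual_space V p" "c *\<^sub>R \<phi> \<in> dual_space V p"
    if "\<phi> \<in> dual_space V p" "\<psi> \<in> dual_space V p" for c \<phi> \<psi>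
    using that subspace_dual_space[OF p] by (auto intro: subspace_add subspace_scale)
  ultimately show ?thesis
    unfolding bidual_space_def
    by (intro dual_spaceI[where C = "p f"]) (simp_all add: natural_map_def scaleR_fun_def)
qed

section \<open>Tychonoff compactness and weak cluster points of bounded filters\<close>

lemma compact_Pi:
  fixes S :: "'i \<Rightarrow> 'b::topological_space set"
  assumes "\<And>i. compact (S i)"
  shows "compact (Pi UNIV S)"
proof -
  have "compactin (product_topology (\<lambda>i. euclidean) UNIV) (Pi\<^sub>E UNIV S)"
    using assms by (simp add: compactin_PiE)
  then show ?thesis
    by (simp add: euclidean_product_topology PiE_UNIV_domain)
qed

lemma filterlim_inf_filtercomap:
  "filterlim f G (inf F (filtercomap f G))"
  by (rule filterlim_mono[OF filterlim_filtercomap order.refl]) simp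

text \<open>The filter form of passing to a subnet along which \<open>f\<close> converges. Were the
  smaller filter trivial, some \<open>R\<close> eventually true in \<open>G\<close> would eventually
  fail on the image of \<open>F\<close>, against the assumption.\<close>

lemma inf_filtercomap_neq_bot:
  assumes "inf G (filtermap f F) \<noteq> bot"
  shows "inf F (filtercomap f G) \<noteq> bot"
proof
  assume "inf F (filtercomap f G) = bot"
  then obtain P Q where "eventually P F" "eventually Q (filtercomap f G)" "\<And>x. \<not> (P x \<and> Q x)"
    unfolding trivial_limit_def eventually_inf by auto
  moreover from this obtain R where R: "eventually R G" "\<And>x. R (f x) \<Longrightarrow> Q x"
    by (auto simp: eventually_filtercomap)
  ultimately have "eventually (\<lambda>y. \<not> R y) (filtermap f F)"
    unfolding eventually_filtermap by (auto elim!: eventually_mono)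
  then have "inf G (filtermap f F) = bot"
    using R(1) unfolding trivial_limit_def eventually_inf by blast
  with assms show False by contradiction
qed

text \<open>Along a bounded filter the functionals \<open>\<phi> \<mapsto> \<phi> g\<close> have a cluster point in the product
  topology by Tychonoff's theorem. Being linear and bounded, it belongs to the bidual.\<close>

lemma bounded_filter_cluster_bidual:
  fixes F :: "'v::real_vector filter"
  assumes p: "seminorm_on V p" and F: "F \<noteq> bot" and ev: "eventually (\<lambda>g. g \<in> V \<and> p g \<le> B) F"
  obtains \<Phi> F' where "\<Phi> \<in> bidual_space V p" "F' \<le> F" "F' \<noteq> bot"
    "\<And>\<phi>. \<phi> \<in> dual_space V p \<Longrightarrow> ((\<lambda>g. \<phi> g) \<longlongrightarrow> \<Phi> \<phi>) F'"
proof -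
  let ?J = "natural_map V p" and ?W = "dual_space V p" and ?n = "dual_norm V p"
  have nn: "?n \<phi> \<ge> 0" if "\<phi> \<in> ?W" for \<phi>
    using seminorm_on_dual_norm[OF p] that by (simp add: seminorm_on_def)
  \<comment> \<open>An element of the ball of radius \<open>B\<close> acts on \<open>\<phi>\<close>
    by a number of modulus at most \<open>B * ?n \<phi>\<close>. The factor \<open>{0}\<close> off
    the dual forces the cluster point to vanish there, as membership in the bidual requires.\<close>
  define S where "S \<phi> = (if \<phi> \<in> ?W then {- (B * ?n \<phi>)..B * ?n \<phi>} else {0})" for \<phi>
  have "compact (Pi UNIV S)"
    by (rule compact_Pi) (simp add: S_def)
  moreover have "eventually (\<lambda>\<Psi>. \<Psi> \<in> Pi UNIV S) (filtermap ?J F)"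
    unfolding eventually_filtermap using ev
  proof eventually_elim
    case (elim g)
    have "\<bar>\<phi> g\<bar> \<le> B * ?n \<phi>" if "\<phi> \<in> ?W" for \<phi>
      using dual_norm_bound[OF p that, of g] elim mult_left_mono[OF conjunct2[OF elim] nn[OF that]]
      by (simp add: mult.commute)
    then show ?case
      by (simp add: S_def natural_map_def abs_le_iff Pi_iff minus_le_iff)
  qed
  moreover have "filtermap ?J F \<noteq> bot"
    using F by (simp add: filtermap_bot_iff)
  ultimately obtain \<Phi> where \<Phi>: "\<Phi> \<in> Pi UNIV S" and "inf (nhds \<Phi>) (filtermap ?J F) \<noteq> bot"
    unfolding compact_filter by metis
  define F' where "F' = inf F (filtercomap ?J (nhds \<Phi>))"
  have F': "F' \<noteq> bot" "F' \<le> F"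
    unfolding F'_def by (rule inf_filtercomap_neq_bot, fact, simp)
  have lim_J: "((\<lambda>g. ?J g \<phi>) \<longlongrightarrow> \<Phi> \<phi>) F'" for \<phi>
  proof (rule topological_tendstoI)
    fix S :: "real set" assume "open S" "\<Phi> \<phi> \<in> S"
    then have "open ((\<lambda>\<Psi>::('v \<Rightarrow> real) \<Rightarrow> real. \<Psi> \<phi>) -` S)" "\<Phi> \<in> (\<lambda>\<Psi>. \<Psi> \<phi>) -` S"
      by (auto intro: open_vimage)
    from topological_tendstoD[OF filterlim_inf_filtercomap this]
    show "eventually (\<lambda>g. ?J g \<phi> \<in> S) F'"
      by (simp add: F'_def)
  qed
  have lim: "((\<lambda>g. \<phi> g) \<longlongrightarrow> \<Phi> \<phi>) F'" if "\<phi> \<in> ?W" for \<phi>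
    using lim_J[of \<phi>] that by (simp add: natural_map_def)
  have "\<Phi> \<in> bidual_space V p"
    unfolding bidual_space_def
  proof (rule dual_spaceI[where C = B])
    fix \<phi> assume "\<phi> \<notin> ?W"
    then show "\<Phi> \<phi> = 0"
      using Pi_mem[OF \<Phi>, of \<phi>] by (simp add: S_def)
  next
    fix \<phi> \<psi> assume *: "\<phi> \<in> ?W" "\<psi> \<in> ?W"
    then have "\<phi> + \<psi> \<in> ?W"
      using subspace_dual_space[OF p] by (simp add: subspace_add)
    then have "((\<lambda>g. (\<phi> + \<psi>) g) \<longlongrightarrow> \<Phi> (\<phi> + \<psi>)) F'"
      by (rule lim)
    moreover have "((\<lambda>g. (\<phi> + \<psi>) g) \<longlongrightarrow> \<Phi> \<phi> + \<Phi> \<psi>) F'"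
      using tendsto_add[OF lim lim] * by simp
    ultimately show "\<Phi> (\<phi> + \<psi>) = \<Phi> \<phi> + \<Phi> \<psi>"
      using F'(1) tendsto_unique by blast
  next
    fix c \<phi> assume *: "\<phi> \<in> ?W"
    then have "c *\<^sub>R \<phi> \<in> ?W"
      using subspace_dual_space[OF p] by (simp add: subspace_scale)
    then have "((\<lambda>g. (c *\<^sub>R \<phi>) g) \<longlongrightarrow> \<Phi> (c *\<^sub>R \<phi>)) F'"
      by (rule lim)
    moreover have "((\<lambda>g. (c *\<^sub>R \<phi>) g) \<longlongrightarrow> c * \<Phi> \<phi>) F'"
      using tendsto_mult[OF tendsto_const lim] * by (simp add: scaleR_fun_def)
    ultimately show "\<Phi> (c *\<^sub>R \<phi>) = c * \<Phi> \<phi>"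
      using F'(1) tendsto_unique by blast
  next
    fix \<phi> assume "\<phi> \<in> ?W"
    then show "\<bar>\<Phi> \<phi>\<bar> \<le> B * ?n \<phi>"
      using Pi_mem[OF \<Phi>, of \<phi>] by (simp add: S_def abs_le_iff minus_le_iff)
  qed
  then show thesis
    using that F' lim by blast
qed

section \<open>Representing bidual elements in reflexive Banach spaces\<close>

lemma banach_imp_seminorm_on: "banach_space_on V p \<Longrightarrow> seminorm_on V p"
  unfolding banach_space_on_def seminorm_on_def by (intro conjI ballI) simp_all

lemma banach_norm_eq_zero_iff: "banach_space_on V p \<Longrightarrow> f \<in> V \<Longrightarrow> p f = 0 \<longleftrightarrow> f = 0"
  by (simp add: banach_space_on_def)

lemma banach_Cauchy_converges:
  fixes u :: "nat \<Rightarrow> 'v::real_vector"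
  assumes "banach_space_on V p" and "\<forall>n. u n \<in> V"
    and "\<forall>\<epsilon>>0. \<exists>N. \<forall>m\<ge>N. \<forall>n\<ge>N. p (u m - u n) < \<epsilon>"
  shows "\<exists>l\<in>V. (\<lambda>n. p (u n - l)) \<longlonglongrightarrow> 0"
  using assms(1)[unfolded banach_space_on_def, THEN conjunct2, THEN conjunct2, THEN conjunct2,
      THEN conjunct2, THEN spec, of u] assms(2,3)
  by (rule mp[OF _ conjI])

text \<open>Separation of \<open>f\<close> from \<open>{0}\<close> with gap \<open>p f\<close>. It
  makes the natural map isometric, so that estimates in the bidual can be carried back to
  \<open>V\<close>.\<close>

lemma norming_functional:
  assumes p: "seminorm_on V p" and f: "f \<in> V"
  obtains \<phi> where "\<phi> \<in> dual_space V p" "dual_norm V p \<phi> \<le> 1" "p f \<le> \<phi> f"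
proof -
  have "{0} \<subseteq> V" "p f \<ge> 0"
    using p f by (auto simp: seminorm_on_def subspace_0)
  then obtain \<phi> where \<phi>: "\<phi> \<in> dual_space V p" "\<And>g. g \<in> V \<Longrightarrow> \<bar>\<phi> g\<bar> \<le> p g" "\<phi> 0 + p f \<le> \<phi> f"
    using dual_space_separation[OF p _ _ _ f, of "{0}" "p f"] by auto
  moreover have "\<phi> 0 = 0"
    using dual_spaceD(3)[OF \<phi>(1), of 0 0] \<open>{0} \<subseteq> V\<close> by simp
  moreover have "dual_norm V p \<phi> \<le> 1"
    using \<phi>(2) by (intro dual_norm_least[OF p]) fastforce
  ultimately show thesis
    using that by simp
qed

text \<open>Completeness leads from density to surjectivity: elements whose images approximate
  \<open>\<Phi>\<close> form a Cauchy sequence, the natural map being isometric, and its limit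
  represents \<open>\<Phi>\<close> because every \<open>\<phi>\<close> is continuous.\<close>

lemma banach_dense_imp_surj_natural_map:
  assumes ban: "banach_space_on V p" and \<Phi>: "\<Phi> \<in> bidual_space V p"
    and dense: "\<And>\<epsilon>. \<epsilon> > 0 \<Longrightarrow> \<exists>f\<in>V. bidual_norm V p (\<Phi> - natural_map V p f) < \<epsilon>"
  obtains h where "h \<in> V" "\<And>\<phi>. \<phi> \<in> dual_space V p \<Longrightarrow> \<Phi> \<phi> = \<phi> h"
proof -
  have p: "seminorm_on V p"
    by (rule banach_imp_seminorm_on[OF ban])
  then have V: "subspace V" by (simp add: seminorm_on_def)
  let ?n = "dual_norm V p" and ?W = "dual_space V p"
  have "\<exists>f. f \<in> V \<and> bidual_norm V p (\<Phi> - natural_map V p f) < inverse (real (Suc k))" for k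
    using dense[of "inverse (real (Suc k))"] by auto
  then obtain u where u: "\<And>k. u k \<in> V"
      "\<And>k. bidual_norm V p (\<Phi> - natural_map V p (u k)) < inverse (real (Suc k))"
    by metis
  have n: "seminorm_on ?W ?n"
    by (rule seminorm_on_dual_norm[OF p])
  have approx: "\<bar>\<Phi> \<phi> - \<phi> (u k)\<bar> \<le> inverse (real (Suc k)) * ?n \<phi>" if \<phi>: "\<phi> \<in> ?W" for \<phi> k
  proof -
    let ?D = "\<Phi> - natural_map V p (u k)"
    have "?D \<in> bidual_space V p"
      using \<Phi> natural_map_in_bidual_space[OF p u(1)[of k]] subspace_dual_space[OF n]
      unfolding bidual_space_def by (simp add: subspace_diff)
    then have "\<bar>?D \<phi>\<bar> \<le> bidual_norm V p ?D * ?n \<phi>"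
      unfolding bidual_space_def bidual_norm_def by (rule dual_norm_bound[OF n _ \<phi>])
    also have "\<dots> \<le> inverse (real (Suc k)) * ?n \<phi>"
      using u(2)[of k] n \<phi> by (intro mult_right_mono) (auto simp: seminorm_on_def)
    finally show ?thesis
      using \<phi> by (simp add: natural_map_def)
  qed
  \<comment> \<open>A norming \<open>\<phi>\<close> for the difference, with both of its terms
    compared to \<open>\<Phi> \<phi>\<close>, moves the estimate from the bidual to
    \<open>V\<close>.\<close>
  have dist: "p (u k - u l) \<le> inverse (real (Suc k)) + inverse (real (Suc l))" for k l
  proof -
    have "u k - u l \<in> V"
      using u V by (simp add: subspace_diff)
    then obtain \<phi> where \<phi>: "\<phi> \<in> ?W" "?n \<phi> \<le> 1" "p (u k - u l) \<le> \<phi> (u k - u l)"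
      using norming_functional[OF p] by blast
    have "\<phi> (u k - u l) = \<phi> (u k) - \<phi> (u l)"
      using dual_spaceD(2)[OF \<phi>(1), of "u k - u l" "u l"] \<open>u k - u l \<in> V\<close> u(1) by simp
    moreover have "inverse (real (Suc j)) * ?n \<phi> \<le> inverse (real (Suc j))" for j
      using \<phi>(2) by (intro mult_left_le) auto
    ultimately show ?thesis
      using \<phi>(3) approx[OF \<phi>(1), of k] approx[OF \<phi>(1), of l] by (smt (verit))
  qed
  have "\<exists>N. \<forall>m\<ge>N. \<forall>n\<ge>N. p (u m - u n) < \<epsilon>" if "\<epsilon> > 0" for \<epsilon>
  proof -
    obtain N where N: "inverse (real (Suc N)) < \<epsilon> / 2"
      using reals_Archimedean[of "\<epsilon> / 2"] \<open>\<epsilon> > 0\<close> by auto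
    have "inverse (real (Suc m)) < \<epsilon> / 2" if "m \<ge> N" for m
      using N that by (smt (verit) le_imp_inverse_le of_nat_0_less_iff of_nat_le_iff Suc_le_mono zero_less_Suc)
    then have "p (u m - u n) < \<epsilon>" if "m \<ge> N" "n \<ge> N" for m n
      using dist[of m n] that by (smt (verit) field_sum_of_halves)
    then show ?thesis by blast
  qed
  then obtain h where h: "h \<in> V" "(\<lambda>k. p (u k - h)) \<longlonglongrightarrow> 0"
    using banach_Cauchy_converges[OF ban, of u] u(1) by blast
  have "\<Phi> \<phi> = \<phi> h" if \<phi>: "\<phi> \<in> ?W" for \<phi>
  proof -
    have "(\<lambda>k. \<phi> (u k) - \<phi> h) \<longlonglongrightarrow> 0"
    proof (rule Lim_null_comparison)
      have "u k - h \<in> V" for k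
        using u h V by (simp add: subspace_diff)
      moreover from this have "\<phi> (u k) = \<phi> (u k - h) + \<phi> h" for k
        using dual_spaceD(2)[OF \<phi>, of "u k - h" h] h(1) by simp
      ultimately show "eventually (\<lambda>k. norm (\<phi> (u k) - \<phi> h) \<le> ?n \<phi> * p (u k - h)) sequentially"
        using dual_norm_bound[OF p \<phi>] by (simp add: eventually_sequentially)
      show "(\<lambda>k. ?n \<phi> * p (u k - h)) \<longlonglongrightarrow> 0"
        using tendsto_mult[OF tendsto_const h(2)] by simp
    qed
    then have "(\<lambda>k. \<phi> (u k)) \<longlonglongrightarrow> \<phi> h"
      by (simp add: LIM_zero_iff)
    moreover have "(\<lambda>k. \<Phi> \<phi> - \<phi> (u k)) \<longlonglongrightarrow> 0"
    proof (rule Lim_null_comparison)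
      show "eventually (\<lambda>k. norm (\<Phi> \<phi> - \<phi> (u k)) \<le> inverse (real (Suc k)) * ?n \<phi>) sequentially"
        using approx[OF \<phi>] by simp
      show "(\<lambda>k. inverse (real (Suc k)) * ?n \<phi>) \<longlonglongrightarrow> 0"
        using tendsto_mult[OF LIMSEQ_inverse_real_of_nat tendsto_const] by simp
    qed
    from tendsto_diff[OF tendsto_const[of "\<Phi> \<phi>"] this] have "(\<lambda>k. \<phi> (u k)) \<longlonglongrightarrow> \<Phi> \<phi>"
      by simp
    ultimately show ?thesis
      using LIMSEQ_unique by blast
  qed
  then show thesis
    using that h(1) by blast
qed

subsection \<open>Luxemburg seminorms\<close>

lemma lower_semicontinuous_le:
  assumes "lower_semicontinuous E" and "\<And>x. ((\<lambda>i. g i x) \<longlongrightarrow> f x) F"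
    and F: "F \<noteq> bot" and le: "eventually (\<lambda>i. E (g i) \<le> C) F"
  shows "E f \<le> C"
proof (rule ccontr)
  assume "\<not> E f \<le> C"
  moreover have "E f \<le> Liminf F (\<lambda>i. E (g i))"
    using assms(1,2) by (rule lower_semicontinuousD)
  ultimately have "C < Liminf F (\<lambda>i. E (g i))"
    by (metis less_le_trans not_le)
  then have "eventually (\<lambda>i. C < E (g i)) F"
    by (rule less_LiminfD)
  with le have "eventually (\<lambda>i. False) F"
    by eventually_elim simp
  with F show False
    by (simp add: trivial_limit_def)
qed

locale convex_modular =
  fixes E :: "('x \<Rightarrow> real) \<Rightarrow> ennreal"
  assumes convex: "convex_functional E" and E_zero: "E 0 = 0" and symmetric: "symmetric_functional E"
begin

abbreviation "M \<equiv> modular_cone E"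
abbreviation "L \<equiv> luxemburg E"

lemma E_convex: "u \<ge> 0 \<Longrightarrow> v \<ge> 0 \<Longrightarrow> u + v = 1 \<Longrightarrow>
    E (u *\<^sub>R f + v *\<^sub>R g) \<le> ennreal u * E f + ennreal v * E g"
  using convex by (simp add: convex_functional_def)

lemma E_minus: "E (- f) = E f"
  using symmetric by (simp add: symmetric_functional_def)

lemma E_scaleR_abs: "E (c *\<^sub>R f) = E (\<bar>c\<bar> *\<^sub>R f)"
  using E_minus[of "c *\<^sub>R f"] by (simp add: abs_if)

lemma E_scaleR_le: "0 \<le> c \<Longrightarrow> c \<le> 1 \<Longrightarrow> E (c *\<^sub>R f) \<le> ennreal c * E f"
  using E_convex[of c "1 - c" f 0] E_zero by simp

lemma E_scaleR_le_self: "0 \<le> c \<Longrightarrow> c \<le> 1 \<Longrightarrow> E (c *\<^sub>R f) \<le> E f"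
  using E_scaleR_le[of c f] mult_right_mono[of "ennreal c" 1 "E f"] by (simp add: order_trans)

lemma E_scaleR_mono: "0 \<le> c \<Longrightarrow> c \<le> d \<Longrightarrow> E (c *\<^sub>R f) \<le> E (d *\<^sub>R f)"
  using E_scaleR_le_self[of "c / d" "d *\<^sub>R f"] by (cases "d = 0") (auto simp: divide_le_eq)

lemma convex_sublevel: "convex {f. E f \<le> C}"
proof (rule convexI, safe)
  fix f g and u v :: real
  assume *: "E f \<le> C" "E g \<le> C" "0 \<le> u" "0 \<le> v" "u + v = 1"
  have "E (u *\<^sub>R f + v *\<^sub>R g) \<le> ennreal u * E f + ennreal v * E g"
    using * by (intro E_convex)
  also have "\<dots> \<le> ennreal u * C + ennreal v * C"
    using * by (intro add_mono mult_left_mono) auto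
  also have "\<dots> = (ennreal u + ennreal v) * C"
    by (simp add: distrib_right)
  also have "\<dots> = ennreal (u + v) * C"
    using *(3,4) by simp
  finally show "E (u *\<^sub>R f + v *\<^sub>R g) \<le> C"
    using * by simp
qed

text \<open>By convexity and \<open>E 0 = 0\<close>, for \<open>0 < a < c\<close> the value
  \<open>E (a *\<^sub>R f)\<close> is at most \<open>a / c\<close> times
  \<open>E (c *\<^sub>R f)\<close>; one finite value thus forces linear decay at 0.\<close>

lemma mem_coneI:
  assumes c: "c > 0" and fin: "E (c *\<^sub>R f) < \<infinity>"
  shows "f \<in> M"
proof -
  obtain r where r: "r \<ge> 0" "E (c *\<^sub>R f) = ennreal r"
    using fin by (cases "E (c *\<^sub>R f)") auto
  have "((\<lambda>a. ennreal (a / c * r)) \<longlongrightarrow> ennreal (0 / c * r)) (at_right 0)"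
    by (intro tendsto_intros) (use c in auto)
  then have lim: "((\<lambda>a. ennreal (a / c * r)) \<longlongrightarrow> 0) (at_right 0)"
    by simp
  have "E (a *\<^sub>R f) \<le> ennreal (a / c * r)" if "a > 0" "a < c" for a
  proof -
    have "E (a *\<^sub>R f) = E ((a / c) *\<^sub>R c *\<^sub>R f)"
      using c by simp
    also have "\<dots> \<le> ennreal (a / c) * ennreal r"
      using E_scaleR_le[of "a / c" "c *\<^sub>R f"] that c r by simp
    also have "\<dots> = ennreal (a / c * r)"
      using that c r by (subst ennreal_mult) auto
    finally show ?thesis .
  qed
  then have "eventually (\<lambda>a. E (a *\<^sub>R f) \<le> ennreal (a / c * r)) (at_right 0)"
    unfolding eventually_at_right_field using c by blast
  then have "((\<lambda>a. E (a *\<^sub>R f)) \<longlongrightarrow> 0) (at_right 0)"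
    by (intro tendsto_sandwich[OF _ _ tendsto_const lim]) auto
  then show ?thesis
    by (simp add: modular_cone_def)
qed

lemma mem_cone_of_finite: "E f < \<infinity> \<Longrightarrow> f \<in> M"
  using mem_coneI[of 1 f] by simp

lemma mem_coneD:
  assumes "f \<in> M"
  obtains c where "c > 0" "E (c *\<^sub>R f) \<le> 1"
proof -
  have "eventually (\<lambda>a. E (a *\<^sub>R f) < 1) (at_right 0)"
    using assms by (intro order_tendstoD(2)[where y = 0]) (auto simp: modular_cone_def)
  then obtain b where "b > 0" "\<And>a. 0 < a \<Longrightarrow> a < b \<Longrightarrow> E (a *\<^sub>R f) < 1"
    unfolding eventually_at_right_field by blast
  then show thesis
    using that[of "b / 2"] by (simp add: less_imp_le)
qed

lemma subspace_cone: "subspace M"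
proof (rule subspaceI)
  show "0 \<in> M"
    using mem_cone_of_finite[of 0] E_zero by simp
next
  fix f g assume "f \<in> M" "g \<in> M"
  then obtain c d where *: "c > 0" "E (c *\<^sub>R f) \<le> 1" "d > 0" "E (d *\<^sub>R g) \<le> 1"
    by (metis mem_coneD)
  \<comment> \<open>At the common scale \<open>e\<close> both functions lie in the convex set where
    \<open>E \<le> 1\<close>; their midpoint is \<open>(e / 2) *\<^sub>R (f + g)\<close>.\<close>
  define e where "e = min c d"
  have "E (e *\<^sub>R f) \<le> 1" "E (e *\<^sub>R g) \<le> 1" "e > 0"
    using * order_trans[OF E_scaleR_mono[of e c f]] order_trans[OF E_scaleR_mono[of e d g]]
    by (auto simp: e_def)
  then have "E ((1/2) *\<^sub>R (e *\<^sub>R f) + (1/2) *\<^sub>R (e *\<^sub>R g)) \<le> 1"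
    using convexD[OF convex_sublevel[of 1], of "e *\<^sub>R f" "e *\<^sub>R g" "1/2" "1/2"] by simp
  then have "E ((e / 2) *\<^sub>R (f + g)) \<le> 1"
    by (simp add: scaleR_add_right)
  then show "f + g \<in> M"
    using \<open>e > 0\<close> by (intro mem_coneI[of "e / 2"]) (auto intro: le_less_trans)
next
  fix a :: real and f assume "f \<in> M"
  then obtain c where c: "c > 0" "E (c *\<^sub>R f) \<le> 1"
    by (rule mem_coneD)
  show "a *\<^sub>R f \<in> M"
  proof (cases "a = 0")
    case True
    then show ?thesis
      using mem_cone_of_finite[of 0] E_zero by simp
  next
    case False
    have "E ((c / \<bar>a\<bar>) *\<^sub>R a *\<^sub>R f) \<le> 1"
      using c False E_scaleR_abs[of "(c / \<bar>a\<bar>) * a" f] by (simp add: abs_mult)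
    then show ?thesis
      using c False by (intro mem_coneI[of "c / \<bar>a\<bar>"]) (auto intro: le_less_trans)
  qed
qed

lemma lux_le: "c > 0 \<Longrightarrow> E (inverse c *\<^sub>R f) \<le> 1 \<Longrightarrow> L f \<le> c"
  unfolding luxemburg_def by (intro cInf_lower bdd_belowI[where m = 0]) auto

lemma lux_set_nonempty: "f \<in> M \<Longrightarrow> {c. c > 0 \<and> E (inverse c *\<^sub>R f) \<le> 1} \<noteq> {}"
proof -
  assume "f \<in> M"
  then obtain c where "c > 0" "E (c *\<^sub>R f) \<le> 1"
    by (rule mem_coneD)
  then have "inverse c \<in> {c. c > 0 \<and> E (inverse c *\<^sub>R f) \<le> 1}"
    by simp
  then show ?thesis by blast
qed

lemma lux_nonneg: "f \<in> M \<Longrightarrow> 0 \<le> L f"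
  unfolding luxemburg_def by (intro cInf_greatest lux_set_nonempty) auto

text \<open>Admissible scales are upward closed, as \<open>E\<close> increases along rays. The
  infimum itself need not be attained, whence the strict inequality.\<close>

lemma lux_lessD:
  assumes "f \<in> M" "L f < c"
  shows "E (inverse c *\<^sub>R f) \<le> 1"
proof -
  obtain d where d: "d > 0" "d < c" "E (inverse d *\<^sub>R f) \<le> 1"
    using cInf_lessD[OF lux_set_nonempty[OF assms(1)]] assms(2) unfolding luxemburg_def by blast
  then have "E (inverse c *\<^sub>R f) \<le> E (inverse d *\<^sub>R f)"
    by (intro E_scaleR_mono) auto
  with d show ?thesis by simp
qed

lemma lux_add:
  assumes f: "f \<in> M" and g: "g \<in> M"
  shows "L (f + g) \<le> L f + L g"
proof (rule field_le_epsilon)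
  fix e :: real assume "e > 0"
  define c d where "c = L f + e / 2" and "d = L g + e / 2"
  have pos: "c > 0" "d > 0"
    using lux_nonneg f g \<open>e > 0\<close> by (simp_all add: c_def d_def add_nonneg_pos)
  have "E (inverse c *\<^sub>R f) \<le> 1" "E (inverse d *\<^sub>R g) \<le> 1"
    using \<open>e > 0\<close> f g by (auto intro!: lux_lessD simp: c_def d_def)
  \<comment> \<open>These weights make (f + g) / (c + d) a convex combination of f / c and g /
    d.\<close>
  then have "E ((c / (c + d)) *\<^sub>R inverse c *\<^sub>R f + (d / (c + d)) *\<^sub>R inverse d *\<^sub>R g) \<le> 1"
    using convexD[OF convex_sublevel[of 1], of "inverse c *\<^sub>R f" "inverse d *\<^sub>R g" "c / (c + d)" "d / (c + d)"] pos
    by (simp add: add_divide_distrib[symmetric])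
  then have "E (inverse (c + d) *\<^sub>R (f + g)) \<le> 1"
    using pos by (simp add: scaleR_add_right inverse_eq_divide)
  then have "L (f + g) \<le> c + d"
    using pos by (intro lux_le) auto
  then show "L (f + g) \<le> L f + L g + e"
    by (simp add: c_def d_def)
qed

lemma lux_scaleR_le:
  assumes f: "f \<in> M" and a: "a \<noteq> 0"
  shows "L (a *\<^sub>R f) \<le> \<bar>a\<bar> * L f"
proof -
  have "L (a *\<^sub>R f) / \<bar>a\<bar> \<le> L f"
  proof (rule dense_ge)
    fix c assume c: "L f < c"
    then have "c > 0" using lux_nonneg[OF f] by simp
    have "\<bar>inverse (\<bar>a\<bar> * c) * a\<bar> = inverse c"
      using a \<open>c > 0\<close> by (simp add: abs_mult)
    then have "E (inverse (\<bar>a\<bar> * c) *\<^sub>R a *\<^sub>R f) = E (inverse c *\<^sub>R f)"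
      using E_scaleR_abs[of "inverse (\<bar>a\<bar> * c) * a" f] by (simp only: scaleR_scaleR)
    then have "L (a *\<^sub>R f) \<le> \<bar>a\<bar> * c"
      using lux_lessD[OF f c] a \<open>c > 0\<close> by (intro lux_le) auto
    then show "L (a *\<^sub>R f) / \<bar>a\<bar> \<le> c"
      using a by (simp add: divide_le_eq mult.commute)
  qed
  then show ?thesis
    using a by (simp add: divide_le_eq mult.commute)
qed

lemma lux_zero: "L 0 = 0"
proof (rule antisym)
  show "L 0 \<le> 0"
    by (rule dense_ge) (auto intro: lux_le simp: E_zero)
  show "0 \<le> L 0"
    using lux_nonneg subspace_0[OF subspace_cone] by blast
qed

lemma lux_scaleR:
  assumes f: "f \<in> M"
  shows "L (a *\<^sub>R f) = \<bar>a\<bar> * L f"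
proof (cases "a = 0")
  case True
  then show ?thesis by (simp add: lux_zero)
next
  case False
  have "L f \<le> inverse \<bar>a\<bar> * L (a *\<^sub>R f)"
    using lux_scaleR_le[of "a *\<^sub>R f" "inverse a"] subspace_scale[OF subspace_cone f] False by simp
  then have "\<bar>a\<bar> * L f \<le> L (a *\<^sub>R f)"
    using False by (simp add: field_simps)
  with lux_scaleR_le[OF f False] show ?thesis by simp
qed

lemma seminorm_on_lux: "seminorm_on M L"
  by (simp add: seminorm_on_def subspace_cone lux_nonneg lux_scaleR lux_add)

text \<open>Sublevel sets are norm bounded, because scaling by a factor in [0,1] shrinks
  \<open>E\<close> at least by that factor; the maximum with 1 keeps the factor in this
  range.\<close>

lemma lux_le_of_sublevel:
  assumes "C \<ge> 0" "E f \<le> ennreal C"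
  shows "L f \<le> max 1 C"
proof (rule lux_le)
  have "E (inverse (max 1 C) *\<^sub>R f) \<le> ennreal (inverse (max 1 C)) * E f"
    by (intro E_scaleR_le) (auto simp: inverse_le_1_iff)
  also have "\<dots> \<le> ennreal (inverse (max 1 C)) * ennreal C"
    using assms by (intro mult_left_mono) auto
  also have "\<dots> = ennreal (inverse (max 1 C) * C)"
    using assms by (subst ennreal_mult) auto
  also have "\<dots> \<le> 1"
    by (auto simp: field_simps max_def)
  finally show "E (inverse (max 1 C) *\<^sub>R f) \<le> 1" .
qed simp

text \<open>Small norm forces small \<open>E\<close>: \<open>f\<close> is \<open>c\<close> times a
  function with \<open>E \<le> 1\<close>, and convexity contracts by
  \<open>c \<le> 1\<close>.\<close>

lemma E_le_of_lux_less:
  assumes f: "f \<in> M" "L f < c" "c \<le> 1"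
  shows "E f \<le> ennreal c"
proof -
  have "c > 0" using lux_nonneg f by fastforce
  then have "E f = E (c *\<^sub>R inverse c *\<^sub>R f)" by simp
  also have "\<dots> \<le> ennreal c * E (inverse c *\<^sub>R f)"
    using \<open>c > 0\<close> f by (intro E_scaleR_le) auto
  also have "\<dots> \<le> ennreal c * 1"
    using lux_lessD f by (intro mult_left_mono) auto
  finally show ?thesis by simp
qed

text \<open>The step \<open>\<lambda>f = \<lambda>g + (1 - \<lambda>) (\<lambda> / (1 - \<lambda>)) (f - g)\<close> bounds \<^term>\<open>E\<close> at \<open>\<lambda>f\<close>
  only; left-continuity takes the bound to \<open>\<lambda> = 1\<close>.\<close>

lemma sublevel_norm_closed:
  assumes lc: "left_continuous E" and f: "f \<in> M"
    and approx: "\<And>\<epsilon>. \<epsilon> > 0 \<Longrightarrow> \<exists>g\<in>M. E g \<le> C \<and> L (f - g) < \<epsilon>"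
  shows "E f \<le> C"
proof -
  have bound: "E (c *\<^sub>R f) \<le> C" if c: "0 < c" "c < 1" for c
  proof (rule ennreal_le_epsilon)
    fix e :: real assume "e > 0"
    \<comment> \<open>The cap at 1 is needed to pass from a norm bound to a bound on
      \<open>E\<close>. The tolerance \<open>d / a\<close> below becomes \<open>d\<close> after
      multiplication by \<open>a\<close>.\<close>
    define d where "d = min e 1"
    have d: "d > 0" "d \<le> e" "d \<le> 1" using \<open>e > 0\<close> by (auto simp: d_def)
    define a where "a = c / (1 - c)"
    have a: "a > 0" using c by (simp add: a_def)
    obtain g where g: "g \<in> M" "E g \<le> C" "L (f - g) < d / a"
      using approx[of "d / a"] a d by (metis divide_pos_pos)
    have fg: "f - g \<in> M"
      using subspace_diff[OF subspace_cone] f g by blast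
    have "L (a *\<^sub>R (f - g)) < d"
      using g(3) lux_scaleR[OF fg, of a] a by (simp add: less_divide_eq mult.commute)
    then have le_d: "E (a *\<^sub>R (f - g)) \<le> ennreal d"
      using E_le_of_lux_less subspace_scale[OF subspace_cone fg] d by blast
    have "c *\<^sub>R f = c *\<^sub>R g + (1 - c) *\<^sub>R a *\<^sub>R (f - g)"
      using c by (simp add: a_def scaleR_diff_right)
    then have "E (c *\<^sub>R f) \<le> ennreal c * E g + ennreal (1 - c) * E (a *\<^sub>R (f - g))"
      using E_convex[of c "1 - c" g "a *\<^sub>R (f - g)"] c by simp
    also have "\<dots> \<le> 1 * C + 1 * ennreal e"
      using c g order_trans[OF le_d ennreal_leI[OF d(2)]] by (intro add_mono mult_mono) auto
    finally show "E (c *\<^sub>R f) \<le> C + ennreal e" by simp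
  qed
  have "eventually (\<lambda>c. E (c *\<^sub>R f) \<le> C) (at_left 1)"
    unfolding eventually_at_left_field using bound by (intro exI[of _ 0]) auto
  moreover have "((\<lambda>c. E (c *\<^sub>R f)) \<longlongrightarrow> E f) (at_left 1)"
    using lc by (simp add: left_continuous_def)
  ultimately show ?thesis
    by (intro tendsto_upperbound) auto
qed

section \<open>Finite resistances and bounded evaluations\<close>

lemma resistance_infinity_finite_iff:
  "resistance_infinity E x < \<infinity> \<longleftrightarrow> (\<exists>r\<ge>0. \<forall>f. E f \<le> 1 \<longrightarrow> f x \<le> r)"
proof
  assume fin: "resistance_infinity E x < \<infinity>"
  have upper: "ereal (f x) \<le> resistance_infinity E x" if "E f \<le> 1" for f
    unfolding resistance_infinity_def using that by (intro SUP_upper) auto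
  \<comment> \<open>The competitor \<open>0\<close> excludes the value minus infinity and makes the
    bound nonnegative.\<close>
  obtain r where r: "resistance_infinity E x = ereal r"
    using fin upper[of 0] E_zero by (cases "resistance_infinity E x") auto
  then show "\<exists>r\<ge>0. \<forall>f. E f \<le> 1 \<longrightarrow> f x \<le> r"
    using upper upper[of 0] E_zero by (intro exI[of _ r]) auto
next
  assume "\<exists>r\<ge>0. \<forall>f. E f \<le> 1 \<longrightarrow> f x \<le> r"
  then obtain r where "\<And>f. E f \<le> 1 \<Longrightarrow> f x \<le> r" by blast
  then have "resistance_infinity E x \<le> ereal r"
    unfolding resistance_infinity_def by (intro SUP_least) auto
  then show "resistance_infinity E x < \<infinity>"
    using le_less_trans by fastforce
qed

lemma resistance_finite_iff:
  "resistance E x y < \<infinity> \<longleftrightarrow> (\<exists>r\<ge>0. \<forall>f. E f \<le> 1 \<longrightarrow> f x - f y \<le> r)"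
proof
  assume fin: "resistance E x y < \<infinity>"
  have upper: "ereal (f x - f y) \<le> resistance E x y" if "E f \<le> 1" for f
    unfolding resistance_def using that by (intro SUP_upper) auto
  obtain r where r: "resistance E x y = ereal r"
    using fin upper[of 0] E_zero by (cases "resistance E x y") auto
  then show "\<exists>r\<ge>0. \<forall>f. E f \<le> 1 \<longrightarrow> f x - f y \<le> r"
    using upper upper[of 0] E_zero by (intro exI[of _ r]) auto
next
  assume "\<exists>r\<ge>0. \<forall>f. E f \<le> 1 \<longrightarrow> f x - f y \<le> r"
  then obtain r where "\<And>f. E f \<le> 1 \<Longrightarrow> f x - f y \<le> r" by blast
  then have "resistance E x y \<le> ereal r"
    unfolding resistance_def by (intro SUP_least) auto
  then show "resistance E x y < \<infinity>"
    using le_less_trans by fastforce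
qed

text \<open>For every \<open>c > L f\<close> both f / c and, by symmetry, - f / c compete in the
  supremum; its finiteness thus means that evaluation at \<open>x\<close> is a bounded
  functional.\<close>

lemma evaluation_bound:
  assumes "resistance_infinity E x < \<infinity>"
  obtains r where "r \<ge> 0" "\<And>f. f \<in> M \<Longrightarrow> \<bar>f x\<bar> \<le> r * L f"
proof -
  obtain r where r: "r \<ge> 0" "\<And>f. E f \<le> 1 \<Longrightarrow> f x \<le> r"
    using assms resistance_infinity_finite_iff by blast
  \<comment> \<open>The surplus 1 allows division, as \<open>r\<close> may be 0.\<close>
  have "\<bar>f x\<bar> \<le> (r + 1) * L f" if f: "f \<in> M" for f
  proof -
    have "\<bar>f x\<bar> / (r + 1) \<le> L f"
    proof (rule dense_ge)
      fix c assume c: "L f < c"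
      then have "c > 0" using lux_nonneg[OF f] by simp
      have "inverse c * f x \<le> r" "- (inverse c * f x) \<le> r"
        using r(2)[of "inverse c *\<^sub>R f"] r(2)[of "- (inverse c *\<^sub>R f)"] lux_lessD[OF f c] E_minus
        by (simp_all add: scaleR_fun_def)
      then have "\<bar>inverse c * f x\<bar> \<le> r" by (rule abs_leI)
      then have "\<bar>f x\<bar> \<le> r * c"
        using \<open>c > 0\<close> by (simp add: abs_mult field_simps)
      also have "\<dots> \<le> (r + 1) * c"
        using \<open>c > 0\<close> by simp
      finally show "\<bar>f x\<bar> / (r + 1) \<le> c"
        using r(1) by (simp add: divide_le_eq mult.commute)
    qed
    then show ?thesis
      using r(1) by (simp add: divide_le_eq mult.commute)
  qed
  then show thesis
    using that[of "r + 1"] r(1) by simp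
qed

section \<open>Consequences of lower semicontinuity: left-continuity, bounded evaluations,
  completeness\<close>

lemma lower_semicontinuous_imp_left_continuous:
  assumes "lower_semicontinuous E"
  shows "left_continuous E"
  unfolding left_continuous_def
proof
  fix f :: "'x \<Rightarrow> real"
  have "((\<lambda>c. c * f x) \<longlongrightarrow> 1 * f x) (at_left 1)" for x
    by (rule tendsto_mult[OF tendsto_ident_at tendsto_const])
  then have "((\<lambda>c. (c *\<^sub>R f) x) \<longlongrightarrow> f x) (at_left 1)" for x
    by (simp add: scaleR_fun_def)
  then have lim: "E f \<le> Liminf (at_left 1) (\<lambda>c. E (c *\<^sub>R f))"
    by (rule lower_semicontinuousD[OF assms])
  show "((\<lambda>c. E (c *\<^sub>R f)) \<longlongrightarrow> E f) (at_left 1)"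
  proof (rule order_tendstoI)
    fix a assume "a < E f"
    then show "eventually (\<lambda>c. a < E (c *\<^sub>R f)) (at_left 1)"
      using lim by (intro less_LiminfD) simp
  next
    fix a assume "E f < a"
    then have "E (c *\<^sub>R f) < a" if "0 < c" "c < 1" for c
      using E_scaleR_le_self[of c f] that by simp
    then show "eventually (\<lambda>c. E (c *\<^sub>R f) < a) (at_left 1)"
      unfolding eventually_at_left_field by (intro exI[of _ 0]) auto
  qed
qed

lemma resistance_imp_resistance_infinity:
  assumes lsc: "lower_semicontinuous E" and ker: "luxemburg_kernel E = {0}"
    and R: "\<And>x y. resistance E x y < \<infinity>"
  shows "resistance_infinity E x < \<infinity>"
proof (rule ccontr)
  assume "\<not> resistance_infinity E x < \<infinity>"
  then have "\<exists>f. E f \<le> 1 \<and> f x > real (Suc n)" for n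
    unfolding resistance_infinity_finite_iff by (meson not_le of_nat_0_le_iff)
  then obtain f where f: "\<And>n. E (f n) \<le> 1" "\<And>n. f n x > real (Suc n)"
    by metis
  have pos: "f n x > 0" for n
    using f(2)[of n] by (metis less_trans of_nat_0_less_iff zero_less_Suc)
  have inv: "inverse (f n x) \<le> inverse (real (Suc n))" for n
    using f(2)[of n] by (intro le_imp_inverse_le) auto
  have inv_lim: "(\<lambda>n. inverse (f n x)) \<longlonglongrightarrow> 0"
    using inv pos by (intro tendsto_sandwich[OF _ _ tendsto_const LIMSEQ_inverse_real_of_nat])
      (auto simp: less_imp_le)
  have lim: "(\<lambda>n. inverse (f n x) * f n y) \<longlonglongrightarrow> 1" for y
  proof -
    obtain r where r: "r \<ge> 0" "\<And>f. E f \<le> 1 \<Longrightarrow> f x - f y \<le> r"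
      using R[of x y] resistance_finite_iff by blast
    \<comment> \<open>Applied to \<open>f n\<close> and \<open>- f n\<close>, the resistance bounds
      the difference on both sides uniformly in \<open>n\<close>. Division by \<open>f n x\<close>,
      which tends to infinity, makes all values agree in the limit.\<close>
    have bound: "\<bar>f n y - f n x\<bar> \<le> r" for n
      using r(2)[of "f n"] r(2)[of "- f n"] f(1)[of n] E_minus[of "f n"] by simp
    have "(\<lambda>n. inverse (f n x) * (f n y - f n x)) \<longlonglongrightarrow> 0"
    proof (rule Lim_null_comparison)
      show "eventually (\<lambda>n. norm (inverse (f n x) * (f n y - f n x)) \<le> inverse (f n x) * r) sequentially"
        using bound pos by (simp add: abs_mult mult_left_mono less_imp_le)
      show "(\<lambda>n. inverse (f n x) * r) \<longlonglongrightarrow> 0"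
        using tendsto_mult[OF inv_lim tendsto_const] by simp
    qed
    from tendsto_add[OF this tendsto_const[of 1]]
    have "(\<lambda>n. inverse (f n x) * (f n y - f n x) + 1) \<longlonglongrightarrow> 1"
      by simp
    moreover have "inverse (f n x) * (f n y - f n x) + 1 = inverse (f n x) * f n y" for n
      using pos[of n] by (simp add: field_simps)
    ultimately show ?thesis by simp
  qed
  define e where "e = (\<lambda>y::'x. 1::real)"
  \<comment> \<open>For fixed \<open>c\<close> the coefficient \<open>c * inverse (f n x)\<close> is
    eventually below 1, so \<open>c *\<^sub>R e\<close> is a pointwise limit of contractions of
    \<open>f n\<close>. Having this for every \<open>c\<close> gives \<open>L e = 0\<close>.\<close>
  have small: "E (c *\<^sub>R e) \<le> 1" if c: "c > 0" for c
  proof (rule lower_semicontinuous_le[OF lsc])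
    show "((\<lambda>n. ((c * inverse (f n x)) *\<^sub>R f n) y) \<longlongrightarrow> (c *\<^sub>R e) y) sequentially" for y
      using tendsto_mult[OF tendsto_const[of c] lim[of y]] by (simp add: scaleR_fun_def e_def mult.assoc)
    have "(\<lambda>n. c * inverse (f n x)) \<longlonglongrightarrow> 0"
      using tendsto_mult[OF tendsto_const inv_lim] by simp
    then have "eventually (\<lambda>n. c * inverse (f n x) < 1) sequentially"
      by (rule order_tendstoD) simp
    then show "eventually (\<lambda>n. E ((c * inverse (f n x)) *\<^sub>R f n) \<le> 1) sequentially"
    proof eventually_elim
      case (elim n)
      then have "E ((c * inverse (f n x)) *\<^sub>R f n) \<le> E (f n)"
        using c pos[of n] by (intro E_scaleR_le_self) auto
      with f(1)[of n] show ?case by simp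
    qed
  qed simp
  have "e \<in> M"
    using small[of 1] by (intro mem_cone_of_finite) (auto intro: le_less_trans)
  moreover have "L e \<le> 0"
    by (rule dense_ge) (use small in \<open>auto intro: lux_le\<close>)
  ultimately have "e \<in> luxemburg_kernel E"
    using lux_nonneg by (auto simp: luxemburg_kernel_def intro: antisym)
  then have "e = 0"
    using ker by simp
  then show False
    by (auto simp: e_def fun_eq_iff)
qed

lemma lower_semicontinuous_imp_banach:
  assumes lsc: "lower_semicontinuous E" and ker: "luxemburg_kernel E = {0}"
    and R: "\<And>x. resistance_infinity E x < \<infinity>"
  shows "banach_space_on M L"
proof -
  have zero_iff: "L f = 0 \<longleftrightarrow> f = 0" if "f \<in> M" for f
    using ker that lux_zero by (auto simp: luxemburg_kernel_def)
  have complete: "\<exists>l\<in>M. (\<lambda>n. L (u n - l)) \<longlonglongrightarrow> 0"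
    if u: "\<And>n. u n \<in> M" and Cauchy: "\<And>\<epsilon>. \<epsilon> > 0 \<Longrightarrow> \<exists>N. \<forall>m\<ge>N. \<forall>n\<ge>N. L (u m - u n) < \<epsilon>" for u
  proof -
    have diff: "u m - u n \<in> M" for m n
      using u subspace_diff[OF subspace_cone] by blast
    have "Cauchy (\<lambda>n. u n x)" for x
    proof (rule CauchyI)
      fix \<epsilon> :: real assume "\<epsilon> > 0"
      obtain r where r: "r \<ge> 0" "\<And>f. f \<in> M \<Longrightarrow> \<bar>f x\<bar> \<le> r * L f"
        using evaluation_bound[OF R] by blast
      obtain N where N: "\<And>m n. m \<ge> N \<Longrightarrow> n \<ge> N \<Longrightarrow> L (u m - u n) < \<epsilon> / (r + 1)"
        using Cauchy[of "\<epsilon> / (r + 1)"] r(1) \<open>\<epsilon> > 0\<close> by auto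
      have "norm (u m x - u n x) < \<epsilon>" if "m \<ge> N" "n \<ge> N" for m n
      proof -
        have "\<bar>u m x - u n x\<bar> \<le> r * L (u m - u n)"
          using r(2)[OF diff, of m n] by simp
        also have "\<dots> \<le> (r + 1) * L (u m - u n)"
          using lux_nonneg[OF diff] by (simp add: mult_right_mono)
        also have "\<dots> < \<epsilon>"
          using N[OF that] r(1) by (simp add: less_divide_eq mult.commute)
        finally show ?thesis by simp
      qed
      then show "\<exists>N. \<forall>m\<ge>N. \<forall>n\<ge>N. norm (u m x - u n x) < \<epsilon>"
        by blast
    qed
    then have "\<exists>y. (\<lambda>n. u n x) \<longlonglongrightarrow> y" for x
      using Cauchy_convergent convergent_def by blast
    then obtain l where l: "\<And>x. (\<lambda>n. u n x) \<longlonglongrightarrow> l x"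
      by metis
    \<comment> \<open>With \<open>m\<close> fixed and \<open>n\<close> tending to infinity, the
      bound \<open>E \<le> 1\<close> on the rescaled differences survives the pointwise
      limit.\<close>
    have near: "\<exists>N. \<forall>m\<ge>N. E (inverse \<epsilon> *\<^sub>R (u m - l)) \<le> 1" if "\<epsilon> > 0" for \<epsilon>
    proof -
      obtain N where N: "\<And>m n. m \<ge> N \<Longrightarrow> n \<ge> N \<Longrightarrow> L (u m - u n) < \<epsilon>"
        using Cauchy[OF \<open>\<epsilon> > 0\<close>] by blast
      have "E (inverse \<epsilon> *\<^sub>R (u m - l)) \<le> 1" if "m \<ge> N" for m
      proof (rule lower_semicontinuous_le[OF lsc])
        show "((\<lambda>n. (inverse \<epsilon> *\<^sub>R (u m - u n)) x) \<longlongrightarrow> (inverse \<epsilon> *\<^sub>R (u m - l)) x) sequentially" for x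
          by (simp add: scaleR_fun_def) (intro tendsto_intros l)
        show "eventually (\<lambda>n. E (inverse \<epsilon> *\<^sub>R (u m - u n)) \<le> 1) sequentially"
          using lux_lessD[OF diff N] that by (auto simp: eventually_sequentially)
      qed simp
      then show ?thesis by blast
    qed
    \<comment> \<open>One index suffices to place the limit in the cone: \<open>u N - l\<close> has
      finite \<open>E\<close>, and \<open>M\<close> is a subspace.\<close>
    obtain N where "E (inverse 1 *\<^sub>R (u N - l)) \<le> 1"
      using near[of 1] by auto
    then have "u N - l \<in> M"
      by (intro mem_cone_of_finite) (auto intro: le_less_trans)
    then have lM: "l \<in> M"
      using subspace_diff[OF subspace_cone u[of N]] by fastforce
    have "(\<lambda>n. L (u n - l)) \<longlonglongrightarrow> 0"
    proof (rule LIMSEQ_I)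
      fix \<epsilon> :: real assume "\<epsilon> > 0"
      \<comment> \<open>Half of \<open>\<epsilon>\<close>, because \<open>E \<le> 1\<close> yields
        only a non-strict bound on \<open>L\<close>.\<close>
      then obtain N where N: "\<And>m. m \<ge> N \<Longrightarrow> E (inverse (\<epsilon> / 2) *\<^sub>R (u m - l)) \<le> 1"
        using near[of "\<epsilon> / 2"] by auto
      have "L (u m - l) < \<epsilon>" if "m \<ge> N" for m
        using lux_le[OF _ N[OF that]] \<open>\<epsilon> > 0\<close> by fastforce
      moreover have "L (u m - l) \<ge> 0" for m
        using lux_nonneg subspace_diff[OF subspace_cone u lM] by blast
      ultimately show "\<exists>N. \<forall>n\<ge>N. norm (L (u n - l) - 0) < \<epsilon>"
        by auto
    qed
    with lM show ?thesis by blast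
  qed
  show ?thesis
    unfolding banach_space_on_def
    by (intro conjI allI ballI impI subspace_cone lux_nonneg zero_iff lux_scaleR lux_add complete) blast+
qed

section \<open>Lower semicontinuity from reflexivity and bounded evaluations\<close>

lemma evaluation_in_dual_space:
  assumes "resistance_infinity E x < \<infinity>"
  shows "(\<lambda>f. if f \<in> M then f x else 0) \<in> dual_space M L"
proof -
  obtain r where "\<And>f. f \<in> M \<Longrightarrow> \<bar>f x\<bar> \<le> r * L f"
    using evaluation_bound[OF assms] by blast
  then show ?thesis
    using subspace_add[OF subspace_cone] subspace_scale[OF subspace_cone]
    by (intro dual_spaceI[where C = r]) (auto simp: scaleR_fun_def)
qed

lemma reflexive_imp_lower_semicontinuous:
  assumes refl: "reflexive_functional E" and lc: "left_continuous E"
    and ban: "banach_space_on M L" and R: "\<And>x. resistance_infinity E x < \<infinity>"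
  shows "lower_semicontinuous E"
  unfolding lower_semicontinuous_def
proof (intro allI impI)
  fix f and F :: "('x \<Rightarrow> real) filter"
  assume pointwise: "\<forall>x. ((\<lambda>g. g x) \<longlongrightarrow> f x) F"
  show "E f \<le> Liminf F E"
    unfolding le_Liminf_iff
  proof (intro allI impI, rule ccontr)
    fix C assume C: "C < E f" and not_ev: "\<not> eventually (\<lambda>g. C < E g) F"
    define K where "K = {g. E g \<le> C}"
    \<comment> \<open>Failing to exceed \<open>C\<close> eventually means that \<open>F\<close>
      meets \<open>K\<close>; \<open>G\<close> is the trace of \<open>F\<close> on this sublevel
      set.\<close>
    define G where "G = inf F (principal K)"
    have "G \<noteq> bot"
      using not_ev unfolding G_def K_def trivial_limit_def
      by (auto simp: eventually_inf_principal not_le elim!: eventually_mono)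
    \<comment> \<open>Being below \<open>E f\<close>, the level \<open>C\<close> is finite; this
      places \<open>K\<close> in \<open>M\<close> and bounds it in norm.\<close>
    obtain B where B: "B \<ge> 0" "C = ennreal B"
      using C by (cases C) auto
    have "g \<in> M" if "g \<in> K" for g
      using that B(2) by (intro mem_cone_of_finite) (auto simp: K_def intro: le_less_trans)
    moreover have "0 \<in> K"
      by (simp add: K_def E_zero)
    ultimately have K: "K \<subseteq> M" "convex K" "K \<noteq> {}"
      using convex_sublevel[of C] by (auto simp: K_def)
    have "eventually (\<lambda>g. g \<in> M \<and> L g \<le> max 1 B) G"
      unfolding G_def eventually_inf_principal using K(1) lux_le_of_sublevel B
      by (intro always_eventually) (auto simp: K_def)
    from bounded_filter_cluster_bidual[OF seminorm_on_lux \<open>G \<noteq> bot\<close> this]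
    obtain \<Phi> G' where \<Phi>: "\<Phi> \<in> bidual_space M L" and G': "G' \<le> G" "G' \<noteq> bot"
      and lim_\<Phi>: "\<And>\<phi>. \<phi> \<in> dual_space M L \<Longrightarrow> ((\<lambda>g. \<phi> g) \<longlongrightarrow> \<Phi> \<phi>) G'"
      by blast
    obtain h where h: "h \<in> M" "\<And>\<phi>. \<phi> \<in> dual_space M L \<Longrightarrow> \<Phi> \<phi> = \<phi> h"
      using banach_dense_imp_surj_natural_map[OF ban \<Phi>] refl \<Phi> unfolding reflexive_functional_def by blast
    have lim: "((\<lambda>g. \<phi> g) \<longlongrightarrow> \<phi> h) G'" if "\<phi> \<in> dual_space M L" for \<phi>
      using lim_\<Phi>[OF that] h(2)[OF that] by simp
    have evK: "eventually (\<lambda>g. g \<in> K) G'"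
      using G'(1) unfolding G_def by (meson eventually_principal filter_leD inf.cobounded2 order_trans)
    \<comment> \<open>Evaluation at \<open>x\<close>, cut off outside \<open>M\<close>, lies in the
      dual and so tends to \<open>h x\<close> along \<open>G'\<close>, where it eventually agrees
      with the true evaluation.\<close>
    have "h x = f x" for x
    proof (rule tendsto_unique[OF G'(2)])
      show "((\<lambda>g. g x) \<longlongrightarrow> f x) G'"
        using pointwise G'(1) unfolding G_def by (meson inf.cobounded1 order_trans tendsto_mono)
      have "((\<lambda>g. if g \<in> M then g x else 0) \<longlongrightarrow> h x) G'"
        using lim[OF evaluation_in_dual_space[OF R, of x]] h(1) by simp
      moreover have "eventually (\<lambda>g. (if g \<in> M then g x else 0) = g x) G'"
        using evK K(1) by (auto elim!: eventually_mono)
      ultimately show "((\<lambda>g. g x) \<longlongrightarrow> h x) G'"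
        by (simp add: tendsto_cong)
    qed
    then have "h = f" by (rule ext)
    then have f: "f \<in> M" using h by simp
    \<comment> \<open>If \<open>K\<close> came arbitrarily close to \<open>f\<close> in norm,
      closedness would give \<open>E f \<le> C\<close>; so a positive distance \<open>d\<close>
      remains.\<close>
    have "\<not> (\<forall>\<epsilon>>0. \<exists>k\<in>M. E k \<le> C \<and> L (f - k) < \<epsilon>)"
      using sublevel_norm_closed[OF lc f, of C] C leD by blast
    then obtain d where d: "d > 0" and far: "\<not> (\<exists>k\<in>M. E k \<le> C \<and> L (f - k) < d)"
      by blast
    have sep: "d \<le> L (f - k)" if "k \<in> K" for k
    proof (rule leI, rule notI)
      assume "L (f - k) < d"
      with that K(1) have "\<exists>k\<in>M. E k \<le> C \<and> L (f - k) < d"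
        by (auto simp: K_def)
      with far show False by contradiction
    qed
    obtain \<phi> where \<phi>: "\<phi> \<in> dual_space M L" "\<And>k. k \<in> K \<Longrightarrow> \<phi> k + d \<le> \<phi> f"
    proof (rule dual_space_separation[OF seminorm_on_lux K f less_imp_le[OF d]])
      show "d \<le> L (f - k)" if "k \<in> K" for k
        by (rule sep[OF that])
    qed (rule that)
    \<comment> \<open>The gap \<open>d\<close> passes to the limit along \<open>G'\<close>, although
      \<open>\<phi> g\<close> tends to \<open>\<phi> h = \<phi> f\<close>.\<close>
    have "eventually (\<lambda>g. \<phi> g \<le> \<phi> f - d) G'"
      using evK by eventually_elim (use \<phi>(2) in \<open>fastforce simp: le_diff_eq\<close>)
    then have "\<phi> h \<le> \<phi> f - d"
      using lim[OF \<phi>(1)] G'(2) by (intro tendsto_upperbound)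
    with d \<open>h = f\<close> show False by simp
  qed
qed

end

theorem theorem3p11:
  fixes E :: "('x \<Rightarrow> real) \<Rightarrow> ennreal"
  assumes "convex_functional E" and "E 0 = 0"
    and "symmetric_functional E" and "reflexive_functional E"
  shows "(lower_semicontinuous E \<and> luxemburg_kernel E = {0} \<and>
            (\<forall>x y. resistance E x y < \<infinity>))
     \<longleftrightarrow> (left_continuous E \<and> banach_space_on (modular_cone E) (luxemburg E) \<and>
            (\<forall>x. resistance_infinity E x < \<infinity>))"
proof -
  interpret convex_modular E
    using assms by unfold_locales
  show ?thesis
  proof (rule iffI; elim conjE)
    assume *: "lower_semicontinuous E" "luxemburg_kernel E = {0}" "\<forall>x y. resistance E x y < \<infinity>"
    then have "\<forall>x. resistance_infinity E x < \<infinity>"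
      using resistance_imp_resistance_infinity by blast
    with * show "left_continuous E \<and> banach_space_on M L \<and> (\<forall>x. resistance_infinity E x < \<infinity>)"
      using lower_semicontinuous_imp_left_continuous lower_semicontinuous_imp_banach by blast
  next
    assume *: "left_continuous E" "banach_space_on M L" "\<forall>x. resistance_infinity E x < \<infinity>"
    have "lower_semicontinuous E"
      using reflexive_imp_lower_semicontinuous assms(4) * by blast
    moreover have "luxemburg_kernel E = {0}"
      using banach_norm_eq_zero_iff[OF *(2)] subspace_0[OF subspace_cone]
      by (auto simp: luxemburg_kernel_def)
    moreover have "resistance E x y < \<infinity>" for x y
    proof -
      \<comment> \<open>The resistance between \<open>x\<close> and \<open>y\<close> is at most the
        sum of their resistances to infinity: the bound at \<open>y\<close> is applied to
        \<open>- f\<close>.\<close>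
      obtain r s where *: "r \<ge> 0" "\<And>f. E f \<le> 1 \<Longrightarrow> f x \<le> r" "s \<ge> 0" "\<And>f. E f \<le> 1 \<Longrightarrow> f y \<le> s"
        using *(3) resistance_infinity_finite_iff by metis
      have "f x - f y \<le> r + s" if "E f \<le> 1" for f
        using *(2)[OF that] *(4)[of "- f"] that by (simp add: E_minus)
      with *(1,3) show ?thesis
        unfolding resistance_finite_iff by (intro exI[of _ "r + s"]) auto
    qed
    ultimately show "lower_semicontinuous E \<and> luxemburg_kernel E = {0} \<and> (\<forall>x y. resistance E x y < \<infinity>)"
      by blast
  qed
qed

end
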